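(* Let $0<a<1$ and let $(a_n)_{n=0}^\infty$ be a sequence of independent real random variables on a probability space $(\Omega,\mathbb{P})$, with $a_n$ uniformly distributed on $(-a^n,a^n)$. Let $(b_n)_{n=0}^\infty$ be a sequence of real numbers with $\lim_{n\to\infty} b_{n+1}/b_n = b$ for some $b>1$ satisfying $ab>1$. Let $\theta_n\in\mathbb{R}$ for $n\in\mathbb{N}$. Let $g:\mathbb{R}\to\mathbb{R}$ be a $C^1$ periodic function having only finitely many critical points in every bounded interval. Define $$f(x)=\sum_{n=0}^\infty a_n\, g(b_n x+\theta_n).$$ Then, almost surely, the Hausdorff dimension and the box dimension of the graph of $f$ are equal to $$D = 2+\frac{\log a}{\log b}.$$
   Context: The graph of $f$ is considered over one period interval $[0,T]$ of $g$, where $T$ is the period of $g$ (the paper normalizes $T=1$ and takes the graph over $[0,1]$). A critical point of $g$ is a point where $g'$ vanishes. *)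

theory Defs
  imports "HOL-Probability.Probability"
begin

definition graph_on :: "real set \<Rightarrow> (real \<Rightarrow> real) \<Rightarrow> (real \<times> real) set" where
  "graph_on I f = {(x, f x) | x. x \<in> I}"

definition hausdorff_approx :: "real \<Rightarrow> real \<Rightarrow> 'a::metric_space set \<Rightarrow> ennreal" where
  "hausdorff_approx s \<delta> E =
     (INF U \<in> {U :: nat \<Rightarrow> 'a set. E \<subseteq> (\<Union>i. U i) \<and> (\<forall>i. bounded (U i) \<and> diameter (U i) \<le> \<delta>)}.
        (\<Sum>i. ennreal (diameter (U i) powr s)))"

definition hausdorff_measure :: "real \<Rightarrow> 'a::metric_space set \<Rightarrow> ennreal" where
  "hausdorff_measure s E = (SUP \<delta> \<in> {0<..}. hausdorff_approx s \<delta> E)"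

definition hausdorff_dim :: "'a::metric_space set \<Rightarrow> real" where
  "hausdorff_dim E = Inf {s. 0 \<le> s \<and> hausdorff_measure s E = 0}"

definition cover_number :: "real \<Rightarrow> 'a::metric_space set \<Rightarrow> nat" where
  "cover_number \<delta> E = (LEAST n. \<exists>U :: nat \<Rightarrow> 'a set.
      E \<subseteq> (\<Union>i<n. U i) \<and> (\<forall>i<n. bounded (U i) \<and> diameter (U i) \<le> \<delta>))"

definition has_box_dim :: "'a::metric_space set \<Rightarrow> real \<Rightarrow> bool" where
  "has_box_dim E d \<longleftrightarrow>
     ((\<lambda>\<delta>. ln (real (cover_number \<delta> E)) / (- ln \<delta>)) \<longlongrightarrow> d) (at_right 0)"

end

theory Submission
  imports Defs
begin

text \<open>
  Upper bounds: almost surely \<open>\<bar>a\<^sub>n\<bar> \<le> a\<^sup>n\<close>, so \<open>f\<close> is Hoelder continuous with every exponent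
  \<open>\<gamma> < - ln a / ln b\<close>, and its graph is covered by \<open>O(\<delta> powr (\<gamma> - 2))\<close> sets of diameter \<open>\<delta>\<close>.

  Lower bounds: for \<open>1 < s < D\<close> the Lebesgue measure lifted to the graph has almost surely finite
  \<open>s\<close>-energy. Conditioning on all coefficients but \<open>a\<^sub>n\<close>, the expectation of
  \<open>max \<bar>x - y\<bar> \<bar>f x - f y\<bar> powr (-s)\<close> is at most a constant times
  \<open>\<bar>x - y\<bar> powr (1 - s) / (a\<^sup>n \<bar>\<Delta>\<^sub>n\<bar>)\<close>, where \<open>\<Delta>\<^sub>n = g (b\<^sub>n x + \<theta>\<^sub>n) - g (b\<^sub>n y + \<theta>\<^sub>n)\<close>, and this
  holds for every \<open>n\<close>. As long as \<open>b\<^sub>n \<bar>x - y\<bar>\<close> is small and \<open>b\<^sub>n x + \<theta>\<^sub>n\<close> stays away from the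
  critical points of \<open>g\<close>, \<open>\<bar>\<Delta>\<^sub>n\<bar>\<close> is comparable to \<open>b\<^sub>n \<bar>x - y\<bar>\<close>. Nothing is assumed about the order of
  the critical points, so near them one passes to a coarser scale: along a sparse subsequence of
  scales, the \<open>x\<close> that are bad at all scales from \<open>k\<close> up to \<open>N\<close> have measure about
  \<open>b\<^sub>k / b\<^sub>N\<close>, which outweighs the loss in using the good scale just below \<open>k\<close>.
\<close>

section \<open>Dimension bounds from covers\<close>

text \<open>For \<open>s > 0\<close> this says that the \<open>s\<close>-dimensional Hausdorff
  content of \<open>E\<close> is at least \<open>c\<close>. No mesh size enters, so one bound serves
  both the Hausdorff and the box dimension.\<close>

definition cover_sums_ge :: "real \<Rightarrow> real \<Rightarrow> 'a::metric_space set \<Rightarrow> bool" where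
  "cover_sums_ge s c E \<longleftrightarrow> (\<forall>U. E \<subseteq> (\<Union>i. U i) \<longrightarrow> (\<forall>i. bounded (U i)) \<longrightarrow>
     ennreal c \<le> (\<Sum>i::nat. ennreal (diameter (U i) powr s)))"

text \<open>Energy method. On some set of positive length the potential of the lifted Lebesgue
  measure is at most \<open>n\<close>. Between points of a cover member of diameter \<open>d\<close>
  the kernel is at least \<open>d powr (-s)\<close>, so the member carries length at most
  \<open>n * d powr s\<close> of that set, and these lengths must add up to the whole.\<close>

lemma graph_cover_lower_bound:
  fixes f :: "real \<Rightarrow> real" and s T :: real
  assumes T: "0 < T" and s: "0 < s" and f [measurable]: "f \<in> borel_measurable borel"
    and fin: "AE x in lborel. x \<in> {0..T} \<longrightarrow>
      (\<integral>\<^sup>+y. ennreal (max \<bar>x - y\<bar> \<bar>f x - f y\<bar> powr (-s)) * indicator {0..T} y \<partial>lborel) < \<infinity>"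
  obtains c where "c > 0"
    and "cover_sums_ge s c (graph_on {0..T} f)"
proof -
  define \<phi> where "\<phi> x = (\<integral>\<^sup>+y. ennreal (max \<bar>x - y\<bar> \<bar>f x - f y\<bar> powr (-s)) * indicator {0..T} y \<partial>lborel)" for x
  have [measurable]: "\<phi> \<in> borel_measurable borel"
    unfolding \<phi>_def by measurable
  \<comment> \<open>The sublevel sets exhaust almost all of \<open>{0..T}\<close>, so one of them
    has positive measure.\<close>
  define E where "E n = {x \<in> {0..T}. \<phi> x \<le> of_nat n}" for n :: nat
  have E_sets [measurable]: "E n \<in> sets lborel" for n
    unfolding E_def by measurable
  have "AE x in lborel. x \<in> {0..T} \<longrightarrow> x \<in> (\<Union>n. E n)"
    using fin
  proof eventually_elim
    case (elim x)
    show ?case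
    proof
      assume x: "x \<in> {0..T}"
      then have "\<phi> x < \<infinity>" using elim by (simp add: \<phi>_def)
      then have "\<exists>n. \<phi> x \<le> of_nat n"
        by (metis ennreal_Ex_less_of_nat infinity_ennreal_def order_less_imp_le)
      then show "x \<in> (\<Union>n. E n)" using x by (auto simp: E_def)
    qed
  qed
  then have "emeasure lborel {0..T} \<le> emeasure lborel (\<Union>n. E n)"
    by (intro emeasure_mono_AE sets.countable_UN) (auto simp: image_subset_iff intro: E_sets[simplified])
  moreover have "emeasure lborel {0..T} = ennreal T" using T by simp
  ultimately have "emeasure lborel (\<Union>n. E n) \<noteq> 0" using T by auto
  then obtain n where n: "emeasure lborel (E n) \<noteq> 0"
    using emeasure_UN_eq_0[of lborel E] E_sets by blast
  have Efin: "emeasure lborel (E n) \<le> ennreal T"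
  proof -
    have "emeasure lborel (E n) \<le> emeasure lborel {0..T}"
      by (intro emeasure_mono) (auto simp: E_def)
    then show ?thesis using T by simp
  qed
  define m where "m = measure lborel (E n)"
  have m: "emeasure lborel (E n) = ennreal m"
    unfolding m_def by (rule emeasure_eq_ennreal_measure) (use Efin in \<open>auto simp: top_unique\<close>)
  have "m > 0" using n m by (metis ennreal_eq_0_iff not_le)
  show ?thesis
  proof
    \<comment> \<open>\<open>n + 1\<close> keeps the denominator positive should \<open>n\<close> be
      0.\<close>
    show "m / (real n + 1) > 0" using \<open>m > 0\<close> by simp
    show "cover_sums_ge s (m / (real n + 1)) (graph_on {0..T} f)"
      unfolding cover_sums_ge_def
    proof (intro allI impI)
      fix U :: "nat \<Rightarrow> (real \<times> real) set"
      assume cov: "graph_on {0..T} f \<subseteq> (\<Union>i. U i)" and "\<forall>i. bounded (U i)"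
      then have bdd: "\<And>i. bounded (U i)" by blast
      \<comment> \<open>\<open>U i\<close> is an arbitrary set; its closure is Borel and has the
        same diameter.\<close>
      define X where "X i = {x \<in> E n. (x, f x) \<in> closure (U i)}" for i
      have X_sets [measurable]: "X i \<in> sets lborel" for i
      proof -
        have "(\<lambda>x. (x, f x)) -` closure (U i) \<inter> space borel \<in> sets borel"
        proof (rule measurable_sets)
          show "(\<lambda>x. (x, f x)) \<in> borel \<rightarrow>\<^sub>M (borel :: (real \<times> real) measure)"
            by measurable
        qed simp
        then have "E n \<inter> ((\<lambda>x. (x, f x)) -` closure (U i)) \<in> sets lborel"
          using E_sets[of n] by (intro sets.Int) auto
        moreover have "X i = E n \<inter> ((\<lambda>x. (x, f x)) -` closure (U i))" by (auto simp: X_def)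
        ultimately show ?thesis by simp
      qed
      have Xi: "emeasure lborel (X i) \<le> ennreal (real n + 1) * ennreal (diameter (U i) powr s)" for i
      proof -
        define d where "d = diameter (U i)"
        have d0: "d \<ge> 0" unfolding d_def using bdd by (rule diameter_ge_0)
        have dist: "max \<bar>x - y\<bar> \<bar>f x - f y\<bar> \<le> d" if "x \<in> X i" "y \<in> X i" for x y
        proof -
          have "dist (x, f x) (y, f y) \<le> diameter (closure (U i))"
            using that bdd[of i] by (intro diameter_bounded_bound) (auto simp: X_def)
          then have D: "dist (x, f x) (y, f y) \<le> d"
            using diameter_closure[OF bdd[of i]] by (simp add: d_def)
          have "\<bar>x - y\<bar> \<le> dist (x, f x) (y, f y)" "\<bar>f x - f y\<bar> \<le> dist (x, f x) (y, f y)"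
            using dist_fst_le[of "(x, f x)" "(y, f y)"] dist_snd_le[of "(x, f x)" "(y, f y)"]
            by (auto simp: dist_real_def)
          then show ?thesis using D by simp
        qed
        consider "X i = {}" | x where "x \<in> X i" "d = 0" | x where "x \<in> X i" "d > 0"
          using d0 by force
        then show ?thesis
        proof cases
          case 1 then show ?thesis by simp
        next
          \<comment> \<open>For \<open>d = 0\<close> the kernel bound is void, since
            \<open>0 powr (-s) = 0\<close>, but then \<open>X i\<close> has at most one
            point.\<close>
          case 2
          then have "X i \<subseteq> {x}" using dist by force
          then have "emeasure lborel (X i) \<le> emeasure lborel {x}" by (intro emeasure_mono) auto
          then show ?thesis by simp
        next
          case 3
          have "ennreal (d powr (-s)) * emeasure lborel (X i)
              = (\<integral>\<^sup>+y. ennreal (d powr (-s)) * indicator (X i) y \<partial>lborel)"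
            by (rule nn_integral_cmult_indicator[OF X_sets, symmetric])
          also have "\<dots> \<le> \<phi> x" unfolding \<phi>_def
          proof (rule nn_integral_mono_AE)
            \<comment> \<open>On the diagonal the kernel is \<open>0 powr (-s) = 0\<close> instead
              of large, so \<open>y = x\<close> is discarded as a null set.\<close>
            have "AE y in lborel. y \<noteq> x" by (rule AE_lborel_singleton)
            then show "AE y in lborel. ennreal (d powr (-s)) * indicator (X i) y
               \<le> ennreal (max \<bar>x - y\<bar> \<bar>f x - f y\<bar> powr (-s)) * indicator {0..T} y"
            proof eventually_elim
              case (elim y)
              show ?case
              proof (cases "y \<in> X i")
                case True
                then have "d powr (-s) \<le> max \<bar>x - y\<bar> \<bar>f x - f y\<bar> powr (-s)"
                  using dist[OF 3(1) True] elim s by (intro powr_mono2') auto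
                moreover have "y \<in> {0..T}" using True by (auto simp: X_def E_def)
                ultimately show ?thesis using True by (simp add: ennreal_leI)
              qed auto
            qed
          qed
          also have "\<dots> \<le> of_nat n" using 3 by (auto simp: X_def E_def)
          finally have *: "ennreal (d powr (-s)) * emeasure lborel (X i) \<le> of_nat n" .
          have "emeasure lborel (X i) = ennreal (d powr s) * (ennreal (d powr (-s)) * emeasure lborel (X i))"
            using 3 by (simp add: mult.assoc[symmetric] ennreal_mult[symmetric] powr_add[symmetric])
          also have "\<dots> \<le> ennreal (d powr s) * of_nat n" using * by (intro mult_left_mono) auto
          also have "\<dots> \<le> ennreal (d powr s) * ennreal (real n + 1)"
            by (intro mult_left_mono) (auto simp: ennreal_of_nat_eq_real_of_nat intro: ennreal_leI)
          finally show ?thesis by (simp add: d_def mult.commute)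
        qed
      qed
      have "E n \<subseteq> (\<Union>i. X i)"
      proof
        fix x assume x: "x \<in> E n"
        then have "(x, f x) \<in> graph_on {0..T} f" by (auto simp: E_def graph_on_def)
        then obtain i where "(x, f x) \<in> U i" using cov by blast
        then show "x \<in> (\<Union>i. X i)" using x closure_subset[of "U i"] by (auto simp: X_def)
      qed
      then have "ennreal m \<le> emeasure lborel (\<Union>i. X i)"
        unfolding m[symmetric] by (intro emeasure_mono sets.countable_UN) (auto intro: X_sets[simplified])
      also have "\<dots> \<le> (\<Sum>i. emeasure lborel (X i))"
        by (intro emeasure_subadditive_countably) (use X_sets in auto)
      also have "\<dots> \<le> (\<Sum>i. ennreal (real n + 1) * ennreal (diameter (U i) powr s))"
        by (intro suminf_le Xi) auto
      also have "\<dots> = ennreal (real n + 1) * (\<Sum>i. ennreal (diameter (U i) powr s))"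
        by simp
      finally have le: "ennreal m \<le> ennreal (real n + 1) * (\<Sum>i. ennreal (diameter (U i) powr s))" .
      have "ennreal (m / (real n + 1)) = ennreal (1 / (real n + 1)) * ennreal m"
        using \<open>m > 0\<close> by (simp add: ennreal_mult[symmetric])
      also have "\<dots> \<le> ennreal (1 / (real n + 1)) * (ennreal (real n + 1) * (\<Sum>i. ennreal (diameter (U i) powr s)))"
        using le by (intro mult_left_mono) auto
      also have "\<dots> = (\<Sum>i. ennreal (diameter (U i) powr s))"
        by (simp add: mult.assoc[symmetric] ennreal_mult[symmetric] del: ennreal_plus)
      finally show "ennreal (m / (real n + 1)) \<le> (\<Sum>i. ennreal (diameter (U i) powr s))" .
    qed
  qed
qed

text \<open>The property minimised in \<open>cover_number\<close>. Naming it separates the existence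
  of a finite cover from the value of \<open>LEAST\<close>, which is meaningful only when such a
  cover exists.\<close>

definition covered_by :: "real \<Rightarrow> nat \<Rightarrow> 'a::metric_space set \<Rightarrow> bool" where
  "covered_by \<delta> n E \<longleftrightarrow>
     (\<exists>U :: nat \<Rightarrow> 'a set. E \<subseteq> (\<Union>i<n. U i) \<and> (\<forall>i<n. bounded (U i) \<and> diameter (U i) \<le> \<delta>))"

lemma covered_by_cover_number:
  assumes "covered_by \<delta> n E"
  shows "covered_by \<delta> (cover_number \<delta> E) E" "cover_number \<delta> E \<le> n"
  using LeastI[of "\<lambda>n. covered_by \<delta> n E", OF assms] Least_le[of "\<lambda>n. covered_by \<delta> n E", OF assms]
  by (simp_all add: cover_number_def covered_by_def)

lemma covered_by_sequence:
  fixes E :: "'a::metric_space set"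
  assumes "covered_by \<delta> n E" "0 \<le> \<delta>"
  obtains U :: "nat \<Rightarrow> 'a set" where "E \<subseteq> (\<Union>i. U i)" "\<And>i. bounded (U i)" "\<And>i. diameter (U i) \<le> \<delta>"
    "\<And>s. 0 \<le> s \<Longrightarrow> (\<Sum>i. ennreal (diameter (U i) powr s)) \<le> ennreal (real n * \<delta> powr s)"
proof -
  from assms obtain V :: "nat \<Rightarrow> 'a set" where V: "E \<subseteq> (\<Union>i<n. V i)"
    "\<And>i. i < n \<Longrightarrow> bounded (V i)" "\<And>i. i < n \<Longrightarrow> diameter (V i) \<le> \<delta>"
    unfolding covered_by_def by blast
  \<comment> \<open>Padding with empty sets is free for every \<open>s\<close>, including
    \<open>s = 0\<close>, because \<open>diameter {} = 0\<close> and
    \<open>0 powr s = 0\<close>.\<close>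
  define U where "U i = (if i < n then V i else {})" for i
  show ?thesis
  proof
    show "E \<subseteq> (\<Union>i. U i)" using V(1) by (fastforce simp: U_def)
    show "bounded (U i)" for i using V by (simp add: U_def)
    show "diameter (U i) \<le> \<delta>" for i using V assms by (simp add: U_def)
    fix s :: real assume s: "0 \<le> s"
    have "(\<Sum>i. ennreal (diameter (U i) powr s)) = (\<Sum>i<n. ennreal (diameter (U i) powr s))"
      by (rule suminf_finite) (auto simp: U_def)
    also have "\<dots> \<le> (\<Sum>i<n. ennreal (\<delta> powr s))"
    proof (rule sum_mono)
      fix i assume "i \<in> {..<n}"
      then show "ennreal (diameter (U i) powr s) \<le> ennreal (\<delta> powr s)"
        using V s by (intro ennreal_leI powr_mono2) (auto simp: U_def diameter_ge_0)
    qed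
    also have "\<dots> = ennreal (real n * \<delta> powr s)"
      by (simp add: ennreal_mult ennreal_of_nat_eq_real_of_nat)
    finally show "(\<Sum>i. ennreal (diameter (U i) powr s)) \<le> ennreal (real n * \<delta> powr s)" .
  qed
qed

text \<open>The content bound keeps the measure positive at nonnegative exponents below
  \<open>D\<close>, and covers by few sets make it vanish above \<open>D\<close>. The exponents in
  \<open>low\<close> need only accumulate at \<open>D\<close> from below, so countably many of them
  will do.\<close>

lemma hausdorff_dim_eqI:
  fixes E :: "'a::metric_space set"
  assumes D: "0 \<le> D"
    and low: "\<And>s. s < D \<Longrightarrow> \<exists>t c. s < t \<and> t < D \<and> 0 < c \<and> cover_sums_ge t c E"
    and up: "\<And>t. D < t \<Longrightarrow> \<exists>C. \<forall>\<delta>\<in>{0<..<1}. \<exists>n. covered_by \<delta> n E \<and> real n \<le> C * \<delta> powr (-t)"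
  shows "hausdorff_dim E = D"
proof -
  have meas0: "hausdorff_measure t E = 0" if t: "D < t" for t
  proof -
    \<comment> \<open>An exponent strictly between \<open>D\<close> and \<open>t\<close> leaves the
      factor \<open>\<eta> powr (t - t')\<close>, which tends to 0 with \<eta>.\<close>
    define t' where "t' = (D + t) / 2"
    have t': "D < t'" "t' < t" using t by (auto simp: t'_def)
    obtain C where C: "\<And>\<delta>. \<delta> \<in> {0<..<1} \<Longrightarrow> \<exists>n. covered_by \<delta> n E \<and> real n \<le> C * \<delta> powr (-t')"
      using up[OF t'(1)] by blast
    have "hausdorff_approx t \<delta> E = 0" if "\<delta> > 0" for \<delta>
    proof -
      have le: "hausdorff_approx t \<delta> E \<le> ennreal (C * \<eta> powr (t - t'))" if \<eta>: "0 < \<eta>" "\<eta> < 1" "\<eta> < \<delta>" for \<eta>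
      proof -
        obtain n where n: "covered_by \<eta> n E" "real n \<le> C * \<eta> powr (-t')" using C[of \<eta>] \<eta> by auto
        obtain U :: "nat \<Rightarrow> 'a set" where U: "E \<subseteq> (\<Union>i. U i)" "\<And>i. bounded (U i)" "\<And>i. diameter (U i) \<le> \<eta>"
            "\<And>s. 0 \<le> s \<Longrightarrow> (\<Sum>i. ennreal (diameter (U i) powr s)) \<le> ennreal (real n * \<eta> powr s)"
          using covered_by_sequence[OF n(1)] \<eta> by (metis less_imp_le)
        have "hausdorff_approx t \<delta> E \<le> (\<Sum>i. ennreal (diameter (U i) powr t))"
          unfolding hausdorff_approx_def
        proof (rule INF_lower, rule CollectI, intro conjI allI)
          show "diameter (U i) \<le> \<delta>" for i using U(3)[of i] \<eta> by simp
        qed (rule U)+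
        also have "\<dots> \<le> ennreal (real n * \<eta> powr t)" using t D by (intro U(4)) simp
        also have "\<dots> \<le> ennreal (C * \<eta> powr (-t') * \<eta> powr t)"
          using n by (intro ennreal_leI mult_right_mono) auto
        also have "C * \<eta> powr (-t') * \<eta> powr t = C * \<eta> powr (t - t')"
          by (simp add: powr_add[symmetric])
        finally show ?thesis .
      qed
      have "((\<lambda>\<eta>. \<eta> powr (t - t')) \<longlongrightarrow> 0) (at_right 0)"
        using t' by (intro tendsto_zero_powrI[where b="t - t'"]) (auto simp: tendsto_ident_at eventually_at_filter)
      then have "((\<lambda>\<eta>. ennreal (C * \<eta> powr (t - t'))) \<longlongrightarrow> ennreal (C * 0)) (at_right 0)"
        by (intro tendsto_ennrealI tendsto_mult_left)
      moreover have "eventually (\<lambda>\<eta>. hausdorff_approx t \<delta> E \<le> ennreal (C * \<eta> powr (t - t'))) (at_right 0)"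
        using eventually_at_right_real[of 0 "min 1 \<delta>"] \<open>\<delta> > 0\<close>
        by (auto elim!: eventually_mono intro!: le)
      ultimately have "hausdorff_approx t \<delta> E \<le> ennreal (C * 0)"
        by (intro tendsto_lowerbound) auto
      then show ?thesis by simp
    qed
    then show ?thesis by (simp add: hausdorff_measure_def)
  qed
  have lower: "D \<le> s" if s: "0 \<le> s" "hausdorff_measure s E = 0" for s
  proof (rule ccontr)
    assume "\<not> D \<le> s"
    then obtain t c where t: "s < t" "t < D" "0 < c" "cover_sums_ge t c E"
      using low[of s] by auto
    \<comment> \<open>Mesh 1 suffices: for diameters at most 1 the \<open>t\<close>-sum is no larger
      than the \<open>s\<close>-sum, so a small \<open>s\<close>-sum contradicts the content bound
      for \<open>t\<close>.\<close>
    have "hausdorff_approx s 1 E \<le> hausdorff_measure s E"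
      unfolding hausdorff_measure_def by (intro SUP_upper) auto
    then have "hausdorff_approx s 1 E < ennreal c" using s t by simp
    then obtain U :: "nat \<Rightarrow> 'a set" where U: "E \<subseteq> (\<Union>i. U i)" "\<And>i. bounded (U i)" "\<And>i. diameter (U i) \<le> 1"
      "(\<Sum>i. ennreal (diameter (U i) powr s)) < ennreal c"
      unfolding hausdorff_approx_def INF_less_iff by blast
    have "ennreal c \<le> (\<Sum>i. ennreal (diameter (U i) powr t))" using t U by (auto simp: cover_sums_ge_def)
    also have "\<dots> \<le> (\<Sum>i. ennreal (diameter (U i) powr s))"
    proof (intro suminf_le ennreal_leI)
      fix i
      show "diameter (U i) powr t \<le> diameter (U i) powr s"
        using U(3)[of i] diameter_ge_0[OF U(2)[of i]] t by (intro powr_mono') auto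
    qed auto
    finally show False using U(4) by simp
  qed
  show ?thesis unfolding hausdorff_dim_def
  proof (rule cInf_eq)
    fix y assume y: "\<And>x. x \<in> {s. 0 \<le> s \<and> hausdorff_measure s E = 0} \<Longrightarrow> y \<le> x"
    show "y \<le> D"
    proof (rule dense_ge)
      fix z assume "D < z"
      then show "y \<le> z" using y[of z] meas0[of z] D by auto
    qed
  qed (use lower in auto)
qed

text \<open>Logarithms turn \<open>c \<le> N \<delta> * \<delta> powr t\<close> and
  \<open>N \<delta> \<le> C * \<delta> powr (-t)\<close> into bounds on the quotient. Multiplicative
  constants disappear in the limit because \<open>- ln \<delta>\<close> tends to infinity.\<close>

lemma has_box_dimI:
  fixes E :: "'a::metric_space set"
  assumes D: "0 < D"
    and low: "\<And>s. s < D \<Longrightarrow> \<exists>t c. s < t \<and> t < D \<and> 0 < c \<and> cover_sums_ge t c E"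
    and up: "\<And>t. D < t \<Longrightarrow> \<exists>C. \<forall>\<delta>\<in>{0<..<1}. \<exists>n. covered_by \<delta> n E \<and> real n \<le> C * \<delta> powr (-t)"
  shows "has_box_dim E D"
proof -
  define N where "N \<delta> = real (cover_number \<delta> E)" for \<delta>
  have ln_top: "filterlim (\<lambda>\<delta>::real. - ln \<delta>) at_top (at_right 0)"
    using ln_at_0 by (simp add: filterlim_uminus_at_top)
  have small: "eventually (\<lambda>\<delta>. 0 < \<delta> \<and> \<delta> < 1) (at_right (0::real))"
    using eventually_at_right_real[of 0 1] by (auto elim: eventually_mono)
  have ratio: "((\<lambda>\<delta>. r + ln c / (- ln \<delta>)) \<longlongrightarrow> r) (at_right 0)" for r c :: real
    using tendsto_add[OF tendsto_const[of r] tendsto_divide_0[OF tendsto_const[of "ln c"] filterlim_at_top_imp_at_infinity[OF ln_top]]]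
    by simp
  \<comment> \<open>Positivity of \<open>N \<delta>\<close> is recorded as well, because the upper
    bound takes its logarithm.\<close>
  have lower_ev: "eventually (\<lambda>\<delta>. r < ln (N \<delta>) / (- ln \<delta>) \<and> 0 < N \<delta>) (at_right 0)" if r: "r < D" for r
  proof -
    \<comment> \<open>The maximum with 0 makes \<open>t\<close> positive, as the sum bound of
      \<open>covered_by_sequence\<close> asks for a nonnegative exponent.\<close>
    obtain t c where t: "max 0 r < t" "t < D" "0 < c" "cover_sums_ge t c E"
      using low[of "max 0 r"] r D by auto
    have "eventually (\<lambda>\<delta>. r < t + ln c / (- ln \<delta>)) (at_right 0)"
      using order_tendstoD(1)[OF ratio[of t c], of r] t by simp
    with small show ?thesis
    proof eventually_elim
      case (elim \<delta>)
      \<comment> \<open>Any finite cover will do here: it makes the \<open>LEAST\<close> in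
        \<open>cover_number\<close> an attained value.\<close>
      obtain C n where "covered_by \<delta> n E"
        using up[of "D + 1"] elim by fastforce
      then have "covered_by \<delta> (cover_number \<delta> E) E" by (rule covered_by_cover_number)
      then obtain U :: "nat \<Rightarrow> 'a set" where U: "E \<subseteq> (\<Union>i. U i)" "\<And>i. bounded (U i)"
            "\<And>s. 0 \<le> s \<Longrightarrow> (\<Sum>i. ennreal (diameter (U i) powr s)) \<le> ennreal (N \<delta> * \<delta> powr s)"
          using covered_by_sequence[of \<delta> "cover_number \<delta> E" E] elim unfolding N_def by (metis less_imp_le)
      have "ennreal c \<le> ennreal (N \<delta> * \<delta> powr t)"
        using t(1,4) U(1,2) by (auto simp: cover_sums_ge_def intro: order_trans[OF _ U(3)])
      then have c: "c \<le> N \<delta> * \<delta> powr t"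
        using t(3) by (subst (asm) ennreal_le_iff) (auto simp: N_def)
      have Npos: "N \<delta> > 0"
      proof (rule ccontr)
        assume "\<not> N \<delta> > 0"
        then have "N \<delta> = 0" by (simp add: N_def)
        then show False using c t(3) by simp
      qed
      have "ln c \<le> ln (N \<delta> * \<delta> powr t)" using c t(3) by simp
      also have "\<dots> = ln (N \<delta>) + t * ln \<delta>" using Npos elim by (simp add: ln_mult ln_powr)
      finally have "ln c \<le> ln (N \<delta>) + t * ln \<delta>" .
      then have "(ln c - t * ln \<delta>) / (- ln \<delta>) \<le> ln (N \<delta>) / (- ln \<delta>)"
        using elim by (intro divide_right_mono) auto
      moreover have "(ln c - t * ln \<delta>) / (- ln \<delta>) = t + ln c / (- ln \<delta>)"
        using elim by (simp add: field_simps)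
      ultimately show ?case using elim Npos by linarith
    qed
  qed
  have upper_ev: "eventually (\<lambda>\<delta>. ln (N \<delta>) / (- ln \<delta>) < r) (at_right 0)" if r: "D < r" for r
  proof -
    define t where "t = (D + r) / 2"
    have t: "D < t" "t < r" using r by (auto simp: t_def)
    obtain C where C: "\<And>\<delta>. \<delta> \<in> {0<..<1} \<Longrightarrow> \<exists>n. covered_by \<delta> n E \<and> real n \<le> C * \<delta> powr (-t)"
      using up[OF t(1)] by blast
    define C' where "C' = max C 1"
    have "eventually (\<lambda>\<delta>. t + ln C' / (- ln \<delta>) < r) (at_right 0)"
      using order_tendstoD(2)[OF ratio[of t C'], of r] t by simp
    with small lower_ev[OF D] show ?thesis
    proof eventually_elim
      case (elim \<delta>)
      obtain n where n: "covered_by \<delta> n E" "real n \<le> C * \<delta> powr (-t)" using C[of \<delta>] elim by auto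
      have "N \<delta> \<le> real n" using covered_by_cover_number(2)[OF n(1)] by (simp add: N_def)
      also have "\<dots> \<le> C' * \<delta> powr (-t)"
        using n(2) mult_right_mono[of C C' "\<delta> powr (-t)"] by (simp add: C'_def)
      finally have "ln (N \<delta>) \<le> ln (C' * \<delta> powr (-t))"
        using elim by simp
      also have "\<dots> = ln C' - t * ln \<delta>" using elim by (simp add: ln_mult ln_powr C'_def)
      finally have "ln (N \<delta>) / (- ln \<delta>) \<le> (ln C' - t * ln \<delta>) / (- ln \<delta>)"
        using elim by (intro divide_right_mono) auto
      moreover have "(ln C' - t * ln \<delta>) / (- ln \<delta>) = t + ln C' / (- ln \<delta>)"
        using elim by (simp add: field_simps)
      ultimately show ?case using elim by linarith
    qed
  qed
  show ?thesis unfolding has_box_dim_def N_def[symmetric]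
  proof (rule order_tendstoI)
    show "eventually (\<lambda>\<delta>. r < ln (N \<delta>) / (- ln \<delta>)) (at_right 0)" if "r < D" for r
      using lower_ev[OF that] by (auto elim: eventually_mono)
  qed (rule upper_ev)
qed


text \<open>A grid of squares of side \<eta>. Over one column the graph stays within \<rho> of its
  value at the left end, so about \<open>2 * \<rho> / \<eta>\<close> squares in each of about
  \<open>T / \<eta>\<close> columns suffice.\<close>

lemma holder_graph_covered_by:
  fixes f :: "real \<Rightarrow> real"
  assumes T: "0 < T" and \<gamma>: "\<gamma> \<le> 1" and C: "0 \<le> C"
    and hol: "\<And>x y. x \<in> {0..T} \<Longrightarrow> y \<in> {0..T} \<Longrightarrow> \<bar>f x - f y\<bar> \<le> C * \<bar>x - y\<bar> powr \<gamma>"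
    and \<gamma>0: "0 \<le> \<gamma>"
    and \<delta>: "0 < \<delta>" "\<delta> < 1"
  shows "\<exists>n. covered_by \<delta> n (graph_on {0..T} f) \<and>
    real n \<le> (T + 1) * (2 * C + 1) * 2 powr (2 - \<gamma>) * \<delta> powr (- (2 - \<gamma>))"
proof -
  \<comment> \<open>Half of \<delta>, since the diameter of a square is bounded by the sum of its
    two side lengths.\<close>
  define \<eta> where "\<eta> = \<delta> / 2"
  have \<eta>: "0 < \<eta>" "\<eta> < 1" using \<delta> by (auto simp: \<eta>_def)
  define \<rho> where "\<rho> = C * \<eta> powr \<gamma>"
  have \<rho>: "0 \<le> \<rho>" using C by (simp add: \<rho>_def)
  define p where "p = nat \<lfloor>T / \<eta>\<rfloor> + 1"
  define q where "q = nat \<lfloor>2 * \<rho> / \<eta>\<rfloor> + 1"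
  \<comment> \<open>The squares of a column are stacked upwards from the lowest height that the
    graph can have there.\<close>
  define l where "l i j = f (real i * \<eta>) - \<rho> + real j * \<eta>" for i j :: nat
  define V where "V i j = {real i * \<eta>..real i * \<eta> + \<eta>} \<times> {l i j..l i j + \<eta>}" for i j
  \<comment> \<open>Quotient and remainder by \<open>q\<close> enumerate the squares by one index
    below \<open>p * q\<close>.\<close>
  define U where "U k = V (k div q) (k mod q)" for k
  have q: "q > 0" by (simp add: q_def)
  have fl: "real (nat \<lfloor>x / \<eta>\<rfloor>) * \<eta> \<le> x" "x \<le> real (nat \<lfloor>x / \<eta>\<rfloor>) * \<eta> + \<eta>" if "0 \<le> x" for x
  proof -
    have "real (nat \<lfloor>x / \<eta>\<rfloor>) = of_int \<lfloor>x / \<eta>\<rfloor>" using that \<eta> by simp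
    then show "real (nat \<lfloor>x / \<eta>\<rfloor>) * \<eta> \<le> x" "x \<le> real (nat \<lfloor>x / \<eta>\<rfloor>) * \<eta> + \<eta>"
      using floor_divide_lower[OF \<eta>(1), of x] floor_divide_upper[OF \<eta>(1), of x]
      by (simp_all add: distrib_right)
  qed
  have cov: "graph_on {0..T} f \<subseteq> (\<Union>k<p * q. U k)"
  proof
    fix z assume "z \<in> graph_on {0..T} f"
    then obtain x where x: "z = (x, f x)" "0 \<le> x" "x \<le> T" by (auto simp: graph_on_def)
    define i where "i = nat \<lfloor>x / \<eta>\<rfloor>"
    have i: "real i * \<eta> \<le> x" "x \<le> real i * \<eta> + \<eta>" unfolding i_def using fl[OF x(2)] .
    have "nat \<lfloor>x / \<eta>\<rfloor> \<le> nat \<lfloor>T / \<eta>\<rfloor>"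
      using x \<eta> by (intro nat_mono floor_mono divide_right_mono) auto
    then have ip: "i < p" by (simp add: i_def p_def)
    have "\<bar>f x - f (real i * \<eta>)\<bar> \<le> C * \<bar>x - real i * \<eta>\<bar> powr \<gamma>"
      using x i \<eta> by (intro hol) auto
    also have "\<dots> \<le> \<rho>" unfolding \<rho>_def using C i \<gamma>0 by (intro mult_left_mono powr_mono2) auto
    finally have d: "\<bar>f x - f (real i * \<eta>)\<bar> \<le> \<rho>" .
    define y where "y = f x - f (real i * \<eta>) + \<rho>"
    have y: "0 \<le> y" "y \<le> 2 * \<rho>" using d by (auto simp: y_def)
    define j where "j = nat \<lfloor>y / \<eta>\<rfloor>"
    have j: "real j * \<eta> \<le> y" "y \<le> real j * \<eta> + \<eta>" unfolding j_def using fl[OF y(1)] .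
    have "nat \<lfloor>y / \<eta>\<rfloor> \<le> nat \<lfloor>2 * \<rho> / \<eta>\<rfloor>"
      using y \<eta> by (intro nat_mono floor_mono divide_right_mono) auto
    then have jq: "j < q" by (simp add: j_def q_def)
    have "z \<in> V i j" using x i j by (auto simp: V_def l_def y_def)
    moreover have "U (i * q + j) = V i j" using jq by (simp add: U_def)
    moreover have "i * q + j < p * q"
    proof -
      have "i * q + j < i * q + q" using jq by simp
      also have "\<dots> = Suc i * q" by simp
      also have "\<dots> \<le> p * q" using ip by (intro mult_right_mono) auto
      finally show ?thesis .
    qed
    ultimately show "z \<in> (\<Union>k<p * q. U k)" by blast
  qed
  have bd: "bounded (V i j)" for i j unfolding V_def by (intro bounded_Times) auto
  have diam: "diameter (V i j) \<le> \<delta>" for i j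
  proof (rule diameter_le)
    show "V i j \<noteq> {} \<or> 0 \<le> \<delta>" using \<delta> by simp
    fix u v assume "u \<in> V i j" "v \<in> V i j"
    then have "\<bar>fst u - fst v\<bar> \<le> \<eta>" "\<bar>snd u - snd v\<bar> \<le> \<eta>" by (auto simp: V_def)
    then have "norm (fst (u - v)) + norm (snd (u - v)) \<le> \<delta>" by (simp add: \<eta>_def)
    then show "norm (u - v) \<le> \<delta>"
      using norm_Pair_le[of "fst (u - v)" "snd (u - v)"] by (simp only: prod.collapse)
  qed
  have "covered_by \<delta> (p * q) (graph_on {0..T} f)"
    unfolding covered_by_def using cov bd diam by (intro exI[of _ U]) (auto simp: U_def)
  moreover have "real (p * q) \<le> (T + 1) * (2 * C + 1) * 2 powr (2 - \<gamma>) * \<delta> powr (- (2 - \<gamma>))"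
  proof -
    have "real p \<le> T / \<eta> + 1" using T \<eta> by (simp add: p_def)
    also have "\<dots> \<le> (T + 1) / \<eta>" using \<eta> by (simp add: field_simps)
    finally have 1: "real p \<le> (T + 1) / \<eta>" .
    have "real q \<le> 2 * \<rho> / \<eta> + 1" using \<rho> \<eta> by (simp add: q_def)
    also have "\<dots> = 2 * C * \<eta> powr (\<gamma> - 1) + 1" using \<eta> by (simp add: \<rho>_def powr_diff)
    \<comment> \<open>\<open>\<eta> powr (\<gamma> - 1)\<close> is at least 1, as
      \<open>\<eta> < 1\<close> and \<open>\<gamma> \<le> 1\<close>, and absorbs the summand
      1.\<close>
    also have "\<dots> \<le> (2 * C + 1) * \<eta> powr (\<gamma> - 1)"
      using powr_mono'[of "\<gamma> - 1" 0 \<eta>] \<eta> \<gamma> by (simp add: algebra_simps)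
    finally have "real (p * q) \<le> ((T + 1) / \<eta>) * ((2 * C + 1) * \<eta> powr (\<gamma> - 1))"
      using 1 T \<eta> by (subst of_nat_mult, intro mult_mono) auto
    also have "\<dots> = (T + 1) * (2 * C + 1) * (\<eta> powr (\<gamma> - 1) * \<eta> powr (-1))"
      using \<eta> by (simp add: powr_minus field_simps)
    also have "\<eta> powr (\<gamma> - 1) * \<eta> powr (-1) = \<eta> powr (- (2 - \<gamma>))"
      by (subst powr_add[symmetric]) (simp add: algebra_simps)
    also have "\<dots> = 2 powr (2 - \<gamma>) * \<delta> powr (- (2 - \<gamma>))"
      using \<delta> powr_minus_divide[of 2 "2 - \<gamma>"] by (simp add: \<eta>_def powr_divide)
    finally show ?thesis by (simp add: mult.assoc)
  qed
  ultimately show ?thesis by blast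
qed

section \<open>Hoelder continuity of the series\<close>

lemma periodic_reduce:
  fixes h :: "real \<Rightarrow> 'a"
  assumes T: "0 < T" and per: "\<And>x. h (x + T) = h x"
  shows "h (x + of_int k * T) = h x" "\<exists>k::int. x - of_int k * T \<in> {0..T}"
proof -
  have nat: "h (y + of_nat n * T) = h y" for n y
  proof (induction n)
    case (Suc n)
    have "h (y + of_nat (Suc n) * T) = h ((y + of_nat n * T) + T)" by (simp add: algebra_simps)
    then show ?case using per Suc by simp
  qed simp
  show "h (x + of_int k * T) = h x"
  proof (cases "k \<ge> 0")
    case True
    then show ?thesis using nat[of x "nat k"] by simp
  next
    case False
    then show ?thesis using nat[of "x + of_int k * T" "nat (-k)"] by simp
  qed
  have "x - of_int \<lfloor>x / T\<rfloor> * T \<in> {0..T}" 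
    using floor_divide_lower[OF T, of x] floor_divide_upper[OF T, of x] by (simp add: distrib_right)
  then show "\<exists>k::int. x - of_int k * T \<in> {0..T}" by blast
qed

lemma periodic_derivative:
  fixes g g' :: "real \<Rightarrow> real"
  assumes "\<And>x. (g has_real_derivative g' x) (at x)" "\<And>x. g (x + T) = g x"
  shows "g' (x + T) = g' x"
proof -
  have "((\<lambda>x. g (x + T)) has_real_derivative g' (x + T)) (at x)"
    using assms(1)[of "x + T"] by (simp add: DERIV_shift)
  then have "(g has_real_derivative g' (x + T)) (at x)" using assms(2) by simp
  then show ?thesis using assms(1) DERIV_unique by blast
qed

lemma periodic_bounded:
  fixes h :: "real \<Rightarrow> real"
  assumes T: "0 < T" and per: "\<And>x. h (x + T) = h x" and cont: "continuous_on UNIV h"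
  obtains B where "0 \<le> B" "\<And>x. \<bar>h x\<bar> \<le> B"
proof -
  have "compact (h ` {0..T})"
    using cont by (intro compact_continuous_image continuous_on_subset[OF cont]) auto
  then have "bounded (h ` {0..T})" by (rule compact_imp_bounded)
  then obtain B where B: "\<And>x. x \<in> {0..T} \<Longrightarrow> \<bar>h x\<bar> \<le> B" unfolding bounded_iff by fastforce
  have "\<bar>h x\<bar> \<le> B" for x
  proof -
    obtain k :: int where k: "x - of_int k * T \<in> {0..T}" using periodic_reduce(2)[where h=h, OF T per] by blast
    have "h x = h (x - of_int k * T)"
      using periodic_reduce(1)[where h=h, OF T per, of "x - of_int k * T" k] by simp
    then show ?thesis using B[OF k] by simp
  qed
  then show ?thesis using that[of B] abs_ge_zero order_trans by metis
qed

text \<open>Increments over distances up to 1 are controlled by the Lipschitz constant, the others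
  by twice the supremum; the sum of both constants works for all exponents at once.\<close>

lemma periodic_C1_holder:
  fixes g g' :: "real \<Rightarrow> real"
  assumes der: "\<And>x. (g has_real_derivative g' x) (at x)" and cont: "continuous_on UNIV g'"
    and T: "0 < T" and per: "\<And>x. g (x + T) = g x"
  obtains H where "0 \<le> H"
    "\<And>\<gamma> u v. 0 \<le> \<gamma> \<Longrightarrow> \<gamma> \<le> 1 \<Longrightarrow> \<bar>g u - g v\<bar> \<le> H * \<bar>u - v\<bar> powr \<gamma>"
proof -
  have contg: "continuous_on UNIV g" using der by (intro DERIV_continuous_on) auto
  obtain B where B: "0 \<le> B" "\<And>x. \<bar>g x\<bar> \<le> B" using periodic_bounded[OF T per contg] by blast
  obtain L where L: "0 \<le> L" "\<And>x. \<bar>g' x\<bar> \<le> L"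
    using periodic_bounded[of T g', OF T periodic_derivative[OF der per] cont] by blast
  have lip: "\<bar>g u - g v\<bar> \<le> L * \<bar>u - v\<bar>" for u v
    using field_differentiable_bound[of UNIV g g' L u v] der L by (auto intro: has_field_derivative_at_within)
  have "\<bar>g u - g v\<bar> \<le> (2 * B + L) * \<bar>u - v\<bar> powr \<gamma>" if \<gamma>: "0 \<le> \<gamma>" "\<gamma> \<le> 1" for \<gamma> u v
  proof (cases "\<bar>u - v\<bar> \<le> 1")
    case True
    have "\<bar>u - v\<bar> \<le> \<bar>u - v\<bar> powr \<gamma>"
      using powr_mono'[of \<gamma> 1 "\<bar>u - v\<bar>"] True \<gamma> by simp
    then have "L * \<bar>u - v\<bar> \<le> L * \<bar>u - v\<bar> powr \<gamma>" using L by (intro mult_left_mono)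
    also have "\<dots> \<le> (2 * B + L) * \<bar>u - v\<bar> powr \<gamma>" using B by (intro mult_right_mono) auto
    finally show ?thesis using lip[of u v] by linarith
  next
    case False
    have "1 \<le> \<bar>u - v\<bar> powr \<gamma>" using False \<gamma> by (intro ge_one_powr_ge_zero) auto
    then have "2 * B + L \<le> (2 * B + L) * \<bar>u - v\<bar> powr \<gamma>" using B L mult_left_mono[of 1 "\<bar>u - v\<bar> powr \<gamma>" "2 * B + L"] by simp
    then show ?thesis using B(2)[of u] B(2)[of v] L by linarith
  qed
  then show ?thesis using that[of "2 * B + L"] B L by simp
qed

lemma random_series_summable:
  fixes \<alpha> :: "nat \<Rightarrow> real"
  assumes a: "0 < a" "a < 1" and \<alpha>: "\<And>n. \<bar>\<alpha> n\<bar> \<le> a ^ n" and B: "\<And>n. \<bar>u n\<bar> \<le> B"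
  shows "summable (\<lambda>n. \<alpha> n * u n)"
proof (rule summable_comparison_test')
  show "summable (\<lambda>n. a ^ n * B)" using a by (intro summable_mult2 summable_geometric) auto
  show "norm (\<alpha> n * u n) \<le> a ^ n * B" for n
    using mult_mono[OF \<alpha>[of n] B[of n]] a by (simp add: abs_mult)
qed

text \<open>The bound holds term by term with constants
  \<open>H * (a ^ n * \<bar>bs n\<bar> powr \<gamma>)\<close>. These are summable by the ratio test,
  since their ratios tend to \<open>a * b powr \<gamma> < 1\<close>.\<close>

lemma lacunary_series_holder:
  fixes \<alpha> bs \<theta> :: "nat \<Rightarrow> real" and g :: "real \<Rightarrow> real"
  assumes a: "0 < a" "a < 1" and b: "1 < b"
    and bs: "(\<lambda>n. bs (Suc n) / bs n) \<longlonglongrightarrow> b"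
    and \<alpha>: "\<And>n. \<bar>\<alpha> n\<bar> \<le> a ^ n"
    and B: "\<And>x. \<bar>g x\<bar> \<le> B" and H: "0 \<le> H" "\<And>u v. \<bar>g u - g v\<bar> \<le> H * \<bar>u - v\<bar> powr \<gamma>"
    and \<gamma>: "0 < \<gamma>" "a * b powr \<gamma> < 1"
  obtains C where "0 \<le> C" "\<And>x y. \<bar>(\<Sum>n. \<alpha> n * g (bs n * x + \<theta> n)) - (\<Sum>n. \<alpha> n * g (bs n * y + \<theta> n))\<bar> \<le> C * \<bar>x - y\<bar> powr \<gamma>"
proof -
  have sm: "summable (\<lambda>n. a ^ n * \<bar>bs n\<bar> powr \<gamma>)"
  proof -
    define c where "c = (a * b powr \<gamma> + 1) / 2"
    have c: "a * b powr \<gamma> < c" "c < 1" using \<gamma> by (auto simp: c_def)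
    have "(\<lambda>n. a * \<bar>bs (Suc n) / bs n\<bar> powr \<gamma>) \<longlonglongrightarrow> a * \<bar>b\<bar> powr \<gamma>"
      using b by (intro tendsto_intros bs) auto
    then have ev: "eventually (\<lambda>n. a * \<bar>bs (Suc n) / bs n\<bar> powr \<gamma> < c) sequentially"
      using c b by (intro order_tendstoD) auto
    \<comment> \<open>Ratios above 1 exclude \<open>bs n = 0\<close>, where the quotient would be 0
      by convention, so the quotient can be multiplied out below.\<close>
    have ev0: "eventually (\<lambda>n. 1 < bs (Suc n) / bs n) sequentially"
      using order_tendstoD(1)[OF bs b] .
    have "eventually (\<lambda>n. a * \<bar>bs (Suc n) / bs n\<bar> powr \<gamma> < c \<and> 1 < bs (Suc n) / bs n) sequentially"
      using ev ev0 by (rule eventually_conj)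
    then obtain N where N: "\<And>n. n \<ge> N \<Longrightarrow> a * \<bar>bs (Suc n) / bs n\<bar> powr \<gamma> < c \<and> 1 < bs (Suc n) / bs n"
      by (auto simp: eventually_sequentially)
    show ?thesis
    proof (rule summable_ratio_test[OF c(2)])
      fix n assume n: "n \<ge> N"
      then have "bs n \<noteq> 0" using N[of n] by auto
      then have "\<bar>bs (Suc n)\<bar> powr \<gamma> = \<bar>bs (Suc n) / bs n\<bar> powr \<gamma> * \<bar>bs n\<bar> powr \<gamma>"
        by (simp add: powr_mult[symmetric] abs_divide)
      then have "a ^ Suc n * \<bar>bs (Suc n)\<bar> powr \<gamma> = (a * \<bar>bs (Suc n) / bs n\<bar> powr \<gamma>) * (a ^ n * \<bar>bs n\<bar> powr \<gamma>)"
        by simp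
      also have "\<dots> \<le> c * (a ^ n * \<bar>bs n\<bar> powr \<gamma>)" using N[OF n] a by (intro mult_right_mono) auto
      finally show "norm (a ^ Suc n * \<bar>bs (Suc n)\<bar> powr \<gamma>) \<le> c * norm (a ^ n * \<bar>bs n\<bar> powr \<gamma>)"
        using a by simp
    qed
  qed
  define C where "C = H * (\<Sum>n. a ^ n * \<bar>bs n\<bar> powr \<gamma>)"
  show ?thesis
  proof
    show "0 \<le> C" unfolding C_def using H a sm by (intro mult_nonneg_nonneg suminf_nonneg) auto
    fix x y
    have s: "summable (\<lambda>n. \<alpha> n * g (bs n * z + \<theta> n))" for z
      by (rule random_series_summable[OF a \<alpha>]) (rule B)
    define d where "d n = \<alpha> n * g (bs n * x + \<theta> n) - \<alpha> n * g (bs n * y + \<theta> n)" for n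
    have dn: "norm (d n) \<le> H * (a ^ n * \<bar>bs n\<bar> powr \<gamma>) * \<bar>x - y\<bar> powr \<gamma>" for n
    proof -
      have "bs n * x + \<theta> n - (bs n * y + \<theta> n) = bs n * (x - y)" by (simp add: algebra_simps)
      then have "\<bar>g (bs n * x + \<theta> n) - g (bs n * y + \<theta> n)\<bar> \<le> H * (\<bar>bs n\<bar> powr \<gamma> * \<bar>x - y\<bar> powr \<gamma>)"
        using H(2)[of "bs n * x + \<theta> n" "bs n * y + \<theta> n"] by (simp add: abs_mult powr_mult)
      then have "\<bar>\<alpha> n\<bar> * \<bar>g (bs n * x + \<theta> n) - g (bs n * y + \<theta> n)\<bar> \<le> a ^ n * (H * (\<bar>bs n\<bar> powr \<gamma> * \<bar>x - y\<bar> powr \<gamma>))"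
        using \<alpha>[of n] a by (intro mult_mono) auto
      then show ?thesis by (simp add: d_def right_diff_distrib[symmetric] abs_mult mult_ac)
    qed
    have "(\<Sum>n. \<alpha> n * g (bs n * x + \<theta> n)) - (\<Sum>n. \<alpha> n * g (bs n * y + \<theta> n)) = (\<Sum>n. d n)"
      unfolding d_def by (rule suminf_diff[OF s s])
    also have "norm (\<Sum>n. d n) \<le> (\<Sum>n. H * (a ^ n * \<bar>bs n\<bar> powr \<gamma>) * \<bar>x - y\<bar> powr \<gamma>)"
      using dn sm by (intro norm_suminf_le summable_mult2 summable_mult) auto
    also have "\<dots> = C * \<bar>x - y\<bar> powr \<gamma>"
      unfolding C_def using sm by (simp add: suminf_mult suminf_mult2[symmetric] summable_mult)
    finally show "\<bar>(\<Sum>n. \<alpha> n * g (bs n * x + \<theta> n)) - (\<Sum>n. \<alpha> n * g (bs n * y + \<theta> n))\<bar> \<le> C * \<bar>x - y\<bar> powr \<gamma>"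
      by simp
  qed
qed

section \<open>Expectation of the energy kernel\<close>

text \<open>The range \<open>\<bar>z\<bar> \<le> h\<close> contributes
  \<open>2 * h powr (1 - s)\<close>, and each tail \<open>h powr (1 - s) / (s - 1)\<close>, finite
  as \<open>s > 1\<close>; the constant is \<open>2 + 2 / (s - 1)\<close>.\<close>

lemma nn_integral_truncated_kernel:
  fixes h s :: real
  assumes h: "0 < h" and s: "1 < s"
  shows "(\<integral>\<^sup>+z. ennreal (max h \<bar>z\<bar> powr (-s)) \<partial>lborel) \<le> ennreal (2 * (s / (s - 1)) * h powr (1 - s))"
proof -
  have tail: "(\<integral>\<^sup>+z. ennreal (z powr (-s)) * indicator {h..} z \<partial>lborel) = ennreal (h powr (1 - s) / (s - 1))"
  proof -
    have "(\<integral>\<^sup>+z. ennreal (z powr (-s)) * indicator {h..} z \<partial>lborel) = ennreal (0 - (h powr (1 - s) / (1 - s)))"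
    proof (rule nn_integral_FTC_atLeast)
      fix z assume "h \<le> z"
      then have z: "z > 0" using h by simp
      have "((\<lambda>z. z powr (1 - s) / (1 - s)) has_real_derivative ((1 - s) * z powr (1 - s - 1)) / (1 - s)) (at z)"
        using z by (intro DERIV_cdivide DERIV_powr[THEN DERIV_cong] derivative_eq_intros) auto
      then show "((\<lambda>z. z powr (1 - s) / (1 - s)) has_real_derivative z powr (-s)) (at z)"
        using s by simp
    next
      have "((\<lambda>z. z powr (1 - s)) \<longlongrightarrow> 0) at_top"
        using s by (intro tendsto_neg_powr) (auto simp: filterlim_ident)
      then show "((\<lambda>z. z powr (1 - s) / (1 - s)) \<longlongrightarrow> 0) at_top"
        by (rule tendsto_divide_zero)
    qed auto
    then show ?thesis using s by (simp add: minus_divide_right)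
  qed
  have refl: "(\<integral>\<^sup>+z. ennreal (\<bar>z\<bar> powr (-s)) * indicator {..-h} z \<partial>lborel)
      = (\<integral>\<^sup>+z. ennreal (z powr (-s)) * indicator {h..} z \<partial>lborel)"
  proof -
    have "(\<integral>\<^sup>+z. ennreal (\<bar>z\<bar> powr (-s)) * indicator {..-h} z \<partial>lborel)
      = ennreal \<bar>-1\<bar> * (\<integral>\<^sup>+z. ennreal (\<bar>0 + (-1) * z\<bar> powr (-s)) * indicator {..-h} (0 + (-1) * z) \<partial>lborel)"
      by (rule nn_integral_real_affine) auto
    also have "\<dots> = (\<integral>\<^sup>+z. ennreal (z powr (-s)) * indicator {h..} z \<partial>lborel)"
      using h by (auto intro!: nn_integral_cong split: split_indicator)
    finally show ?thesis .
  qed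
  have "(\<integral>\<^sup>+z. ennreal (max h \<bar>z\<bar> powr (-s)) \<partial>lborel)
    \<le> (\<integral>\<^sup>+z. ennreal (h powr (-s)) * indicator {-h..h} z + (ennreal (z powr (-s)) * indicator {h..} z
        + ennreal (\<bar>z\<bar> powr (-s)) * indicator {..-h} z) \<partial>lborel)"
  proof (rule nn_integral_mono)
    fix z :: real
    consider "\<bar>z\<bar> \<le> h" | "z > h" | "z < - h" by linarith
    then show "ennreal (max h \<bar>z\<bar> powr (-s)) \<le> ennreal (h powr (-s)) * indicator {-h..h} z + (ennreal (z powr (-s)) * indicator {h..} z
        + ennreal (\<bar>z\<bar> powr (-s)) * indicator {..-h} z)"
      using h by cases (auto simp: max_def indicator_def)
  qed
  also have "\<dots> = ennreal (h powr (-s)) * emeasure lborel {-h..h} + (ennreal (h powr (1 - s) / (s - 1)) + ennreal (h powr (1 - s) / (s - 1)))"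
    using tail refl by (simp add: nn_integral_add nn_integral_cmult_indicator)
  also have "\<dots> = ennreal (h powr (-s) * (2 * h) + (h powr (1 - s) / (s - 1) + h powr (1 - s) / (s - 1)))"
    using h s by (simp add: ennreal_mult[symmetric] ennreal_plus[symmetric] del: ennreal_plus)
  also have "h powr (-s) * (2 * h) = 2 * h powr (1 - s)"
    using h by (simp add: powr_diff powr_minus field_simps)
  also have "2 * h powr (1 - s) + (h powr (1 - s) / (s - 1) + h powr (1 - s) / (s - 1)) = 2 * (s / (s - 1)) * h powr (1 - s)"
  proof -
    have "2 * (s / (s - 1)) = 2 + (1 / (s - 1) + 1 / (s - 1))" using s by (simp add: field_simps)
    then show ?thesis by (simp add: algebra_simps)
  qed
  finally show ?thesis .
qed

text \<open>Condition on \<open>W\<close>. For each value \<open>w\<close> the argument is an affine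
  image of a variable of density \<open>1 / (2 * r)\<close>, so the substitution costs
  \<open>1 / \<bar>d\<bar>\<close>. Integrating over the whole line makes the bound independent of
  \<open>w\<close>.\<close>

lemma (in prob_space) expectation_truncated_kernel:
  fixes X W :: "'a \<Rightarrow> real"
  assumes ind: "indep_var borel X borel W"
    and X: "distr M borel X = uniform_measure lborel {-r<..<r}" and r: "0 < r"
    and d: "d \<noteq> 0" and h: "0 < h" and s: "1 < s"
  shows "(\<integral>\<^sup>+\<omega>. ennreal (max h \<bar>X \<omega> * d + W \<omega>\<bar> powr (-s)) \<partial>M)
    \<le> ennreal (s / (s - 1) * h powr (1 - s) / (r * \<bar>d\<bar>))"
proof -
  have [measurable]: "X \<in> borel_measurable M" "W \<in> borel_measurable M"
    using ind indep_var_rv1 indep_var_rv2 by blast+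
  let ?K = "\<lambda>z. ennreal (max h \<bar>z\<bar> powr (-s))"
  interpret W: prob_space "distr M borel W" by (rule prob_space_distr) simp
  interpret X: prob_space "distr M borel X" by (rule prob_space_distr) simp
  have inner: "(\<integral>\<^sup>+x. ?K (x * d + w) \<partial>distr M borel X) \<le> ennreal (s / (s - 1) * h powr (1 - s) / (r * \<bar>d\<bar>))" for w
  proof -
    have "(\<integral>\<^sup>+x. ?K (x * d + w) \<partial>distr M borel X) = (\<integral>\<^sup>+x. ?K (x * d + w) * indicator {-r<..<r} x \<partial>lborel) / emeasure lborel {-r<..<r}"
      unfolding X by (rule nn_integral_uniform_measure) auto
    also have "emeasure lborel {-r<..<r} = ennreal (2 * r)" using r by simp
    also have "(\<integral>\<^sup>+x. ?K (x * d + w) * indicator {-r<..<r} x \<partial>lborel) / ennreal (2 * r)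
        \<le> (\<integral>\<^sup>+x. ?K (w + d * x) \<partial>lborel) / ennreal (2 * r)"
      by (intro divide_right_mono_ennreal nn_integral_mono) (auto simp: indicator_def algebra_simps)
    also have "(\<integral>\<^sup>+x. ?K (w + d * x) \<partial>lborel) = ennreal (1 / \<bar>d\<bar>) * (\<integral>\<^sup>+z. ?K z \<partial>lborel)"
      using d by (subst nn_integral_real_affine[of ?K d w])
        (auto simp: mult.assoc[symmetric] ennreal_mult[symmetric])
    also have "\<dots> / ennreal (2 * r) \<le> ennreal (1 / \<bar>d\<bar>) * ennreal (2 * (s / (s - 1)) * h powr (1 - s)) / ennreal (2 * r)"
      by (intro divide_right_mono_ennreal mult_left_mono nn_integral_truncated_kernel h s) auto
    also have "\<dots> = ennreal ((1 / \<bar>d\<bar>) * (2 * (s / (s - 1)) * h powr (1 - s)) / (2 * r))"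
      using r s by (subst ennreal_mult[symmetric], simp, simp, subst divide_ennreal) auto
    also have "(1 / \<bar>d\<bar>) * (2 * (s / (s - 1)) * h powr (1 - s)) / (2 * r) = s / (s - 1) * h powr (1 - s) / (r * \<bar>d\<bar>)"
      using r d s by (simp add: field_simps)
    finally show ?thesis .
  qed
  have "(\<integral>\<^sup>+\<omega>. ?K (X \<omega> * d + W \<omega>) \<partial>M)
      = (\<integral>\<^sup>+p. ?K (fst p * d + snd p) \<partial>distr M (borel \<Otimes>\<^sub>M borel) (\<lambda>\<omega>. (X \<omega>, W \<omega>)))"
    by (subst nn_integral_distr) auto
  also have "distr M (borel \<Otimes>\<^sub>M borel) (\<lambda>\<omega>. (X \<omega>, W \<omega>)) = distr M borel X \<Otimes>\<^sub>M distr M borel W"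
    using ind by (simp add: indep_var_distribution_eq)
  also have "(\<integral>\<^sup>+p. ?K (fst p * d + snd p) \<partial>(distr M borel X \<Otimes>\<^sub>M distr M borel W))
      = (\<integral>\<^sup>+w. (\<integral>\<^sup>+x. ?K (x * d + w) \<partial>distr M borel X) \<partial>distr M borel W)"
  proof -
    interpret XW: pair_sigma_finite "distr M borel X" "distr M borel W" ..
    show ?thesis by (subst XW.nn_integral_snd[symmetric]) auto
  qed
  also have "\<dots> \<le> (\<integral>\<^sup>+w. ennreal (s / (s - 1) * h powr (1 - s) / (r * \<bar>d\<bar>)) \<partial>distr M borel W)"
    by (intro nn_integral_mono inner)
  also have "\<dots> = ennreal (s / (s - 1) * h powr (1 - s) / (r * \<bar>d\<bar>))"
    using W.emeasure_space_1 by simp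
  finally show ?thesis .
qed

text \<open>The remainder is a measurable function of the coefficients with index other than
  \<open>n\<close>, and disjoint blocks of an independent family are independent.\<close>

lemma (in prob_space) indep_var_series_remainder:
  fixes A :: "nat \<Rightarrow> 'a \<Rightarrow> real" and d :: "nat \<Rightarrow> real"
  assumes "indep_vars (\<lambda>_. borel) A UNIV"
  shows "indep_var borel (A n) borel (\<lambda>\<omega>. \<Sum>k. if k = n then 0 else A k \<omega> * d k)"
proof -
  let ?P = "\<lambda>J. PiM J (\<lambda>_. borel :: real measure)"
  have *: "indep_var (?P {n}) (\<lambda>\<omega>. restrict (\<lambda>i. A i \<omega>) {n}) (?P (- {n})) (\<lambda>\<omega>. restrict (\<lambda>i. A i \<omega>) (- {n}))"
    by (rule indep_var_restrict[OF assms]) auto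
  have m1: "(\<lambda>u. u n) \<in> ?P {n} \<rightarrow>\<^sub>M borel" by measurable
  have m2: "(\<lambda>u. \<Sum>k. if k = n then 0 else u k * d k) \<in> ?P (- {n}) \<rightarrow>\<^sub>M borel"
  proof (rule borel_measurable_suminf)
    fix k
    show "(\<lambda>u. if k = n then 0 else u k * d k) \<in> ?P (- {n}) \<rightarrow>\<^sub>M borel"
      by (cases "k = n") auto
  qed
  have "indep_var borel ((\<lambda>u. u n) \<circ> (\<lambda>\<omega>. restrict (\<lambda>i. A i \<omega>) {n}))
      borel ((\<lambda>u. \<Sum>k. if k = n then 0 else u k * d k) \<circ> (\<lambda>\<omega>. restrict (\<lambda>i. A i \<omega>) (- {n})))"
    by (rule indep_var_compose[OF * m1 m2])
  also have "(\<lambda>u. u n) \<circ> (\<lambda>\<omega>. restrict (\<lambda>i. A i \<omega>) {n}) = A n" by auto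
  also have "(\<lambda>u. \<Sum>k. if k = n then 0 else u k * d k) \<circ> (\<lambda>\<omega>. restrict (\<lambda>i. A i \<omega>) (- {n}))
      = (\<lambda>\<omega>. \<Sum>k. if k = n then 0 else A k \<omega> * d k)"
    by (auto intro!: ext suminf_cong)
  finally show ?thesis .
qed

lemma (in prob_space) AE_uniform_bound:
  fixes X :: "'a \<Rightarrow> real"
  assumes [measurable]: "X \<in> borel_measurable M"
    and X: "distr M borel X = uniform_measure lborel {-r<..<r}" and r: "0 < r"
  shows "AE \<omega> in M. \<bar>X \<omega>\<bar> \<le> r"
proof -
  have "AE x in distr M borel X. \<bar>x\<bar> \<le> r"
    unfolding X by (rule AE_uniform_measureI) auto
  then show ?thesis by (simp add: AE_distr_iff)
qed

text \<open>With the \<open>n\<close>-th term split off, the rest is independent of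
  \<open>A n\<close>, and the kernel bound applies with slope \<open>u n - v n\<close>. The index is
  free, so the scale can later be chosen according to the two points.\<close>

lemma (in prob_space) expected_series_kernel:
  fixes A :: "nat \<Rightarrow> 'a \<Rightarrow> real"
  assumes a: "0 < a" "a < 1"
    and ind: "indep_vars (\<lambda>_. borel) A UNIV"
    and A: "\<And>n. distr M borel (A n) = uniform_measure lborel {- (a ^ n)<..<a ^ n}"
    and B: "\<And>n. \<bar>u n\<bar> \<le> B" "\<And>n. \<bar>v n\<bar> \<le> B"
    and s: "1 < s" and h: "0 < h" and n: "u n \<noteq> v n"
  shows "(\<integral>\<^sup>+\<omega>. ennreal (max h \<bar>(\<Sum>n. A n \<omega> * u n) - (\<Sum>n. A n \<omega> * v n)\<bar> powr (-s)) \<partial>M)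
    \<le> ennreal (s / (s - 1) * h powr (1 - s) / (a ^ n * \<bar>u n - v n\<bar>))"
proof -
  have [measurable]: "A n \<in> borel_measurable M" for n
    using ind unfolding indep_vars_def by auto
  \<comment> \<open>These bounds make both series converge, so that their difference may be taken
    term by term.\<close>
  have "AE \<omega> in M. \<forall>n. \<bar>A n \<omega>\<bar> \<le> a ^ n"
    using a by (intro AE_all_countable[THEN iffD2] allI AE_uniform_bound A) auto
  then have eq: "AE \<omega> in M. (\<Sum>n. A n \<omega> * u n) - (\<Sum>n. A n \<omega> * v n)
      = A n \<omega> * (u n - v n) + (\<Sum>k. if k = n then 0 else A k \<omega> * (u k - v k))"
  proof eventually_elim
    case (elim \<omega>)
    have su: "summable (\<lambda>n. A n \<omega> * u n)" and sv: "summable (\<lambda>n. A n \<omega> * v n)"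
      using random_series_summable[OF a elim[rule_format]] B by auto
    have "(\<lambda>k. A k \<omega> * (u k - v k)) sums ((\<Sum>n. A n \<omega> * u n) - (\<Sum>n. A n \<omega> * v n))"
      using sums_diff[OF summable_sums[OF su] summable_sums[OF sv]] by (simp add: algebra_simps)
    from sums_diff[OF this sums_single[of n "\<lambda>k. A k \<omega> * (u k - v k)"]]
    have "(\<lambda>k. if k = n then 0 else A k \<omega> * (u k - v k)) sums
        ((\<Sum>n. A n \<omega> * u n) - (\<Sum>n. A n \<omega> * v n) - A n \<omega> * (u n - v n))"
      by (rule sums_cong[THEN iffD1, rotated]) auto
    then show ?case by (simp add: sums_iff)
  qed
  have "(\<integral>\<^sup>+\<omega>. ennreal (max h \<bar>(\<Sum>n. A n \<omega> * u n) - (\<Sum>n. A n \<omega> * v n)\<bar> powr (-s)) \<partial>M)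
     = (\<integral>\<^sup>+\<omega>. ennreal (max h \<bar>A n \<omega> * (u n - v n) + (\<Sum>k. if k = n then 0 else A k \<omega> * (u k - v k))\<bar> powr (-s)) \<partial>M)"
    using eq by (intro nn_integral_cong_AE) (auto elim!: eventually_mono)
  also have "\<dots> \<le> ennreal (s / (s - 1) * h powr (1 - s) / (a ^ n * \<bar>u n - v n\<bar>))"
    using a n h s by (intro expectation_truncated_kernel indep_var_series_remainder[OF ind] A) auto
  finally show ?thesis .
qed

section \<open>Points close to the critical points at many scales\<close>

text \<open>Compactness gives \<open>\<bar>g'\<bar>\<close> a positive minimum on the points of one
  period at distance \<kappa> from the zeros, and periodicity spreads it. From distance
  \<open>2 * \<kappa>\<close>, a step of size \<kappa> keeps the mean value point at distance
  \<kappa>.\<close>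

lemma increment_lower_bound_away_from_zeros:
  fixes g g' :: "real \<Rightarrow> real"
  assumes der: "\<And>x. (g has_real_derivative g' x) (at x)" and cont: "continuous_on UNIV g'"
    and T: "0 < T" and per: "\<And>x. g (x + T) = g x" and \<kappa>: "0 < \<kappa>"
  obtains \<eta> where "0 < \<eta>"
    "\<And>t u. (\<And>z. g' z = 0 \<Longrightarrow> 2 * \<kappa> \<le> \<bar>t - z\<bar>) \<Longrightarrow> \<bar>u\<bar> \<le> \<kappa> \<Longrightarrow> \<eta> * \<bar>u\<bar> \<le> \<bar>g (t + u) - g t\<bar>"
proof -
  note per' = periodic_derivative[OF der per]
  note red = periodic_reduce[where h=g', OF T per']
  define W where "W = {0..T} \<inter> (\<Inter>z\<in>{z. g' z = 0}. {x. \<kappa> \<le> \<bar>x - z\<bar>})"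
  have "compact W" unfolding W_def
    by (intro compact_Int_closed closed_INT ballI closed_Collect_le continuous_intros) auto
  obtain \<eta> where \<eta>: "0 < \<eta>" "\<And>x. x \<in> W \<Longrightarrow> \<eta> \<le> \<bar>g' x\<bar>"
  proof (cases "W = {}")
    \<comment> \<open>If \<kappa> is so large that no point qualifies, any positive \<eta> will
      do.\<close>
    case True
    then show ?thesis using that[of 1] by auto
  next
    case False
    have "continuous_on W (\<lambda>x. \<bar>g' x\<bar>)"
      using continuous_on_subset[OF cont] by (intro continuous_intros) auto
    then obtain x0 where x0: "x0 \<in> W" "\<And>x. x \<in> W \<Longrightarrow> \<bar>g' x0\<bar> \<le> \<bar>g' x\<bar>"
      using continuous_attains_inf[OF \<open>compact W\<close> False] by blast
    have "g' x0 \<noteq> 0" using x0(1) \<kappa> by (auto simp: W_def)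
    then show ?thesis using that[of "\<bar>g' x0\<bar>"] x0 by auto
  qed
  have far: "\<eta> \<le> \<bar>g' x\<bar>" if x: "\<And>z. g' z = 0 \<Longrightarrow> \<kappa> \<le> \<bar>x - z\<bar>" for x
  proof -
    obtain k :: int where k: "x - of_int k * T \<in> {0..T}" using red(2) by blast
    have "\<kappa> \<le> \<bar>x - of_int k * T - z\<bar>" if "g' z = 0" for z
      using x[of "z + of_int k * T"] red(1)[of z k] that by (simp add: algebra_simps)
    then have "x - of_int k * T \<in> W" using k by (auto simp: W_def)
    moreover have "g' (x - of_int k * T) = g' x" using red(1)[of "x - of_int k * T" k] by simp
    ultimately show ?thesis using \<eta>(2) by metis
  qed
  have "\<eta> * \<bar>u\<bar> \<le> \<bar>g (t + u) - g t\<bar>"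
    if t: "\<And>z. g' z = 0 \<Longrightarrow> 2 * \<kappa> \<le> \<bar>t - z\<bar>" and u: "\<bar>u\<bar> \<le> \<kappa>" for t u
  proof -
    have "\<exists>\<xi>. \<bar>\<xi> - t\<bar> \<le> \<bar>u\<bar> \<and> g (t + u) - g t = u * g' \<xi>"
    proof (cases u "0::real" rule: linorder_cases)
      case less
      then obtain \<xi> where "t + u < \<xi>" "\<xi> < t" "g t - g (t + u) = (t - (t + u)) * g' \<xi>"
        using MVT2[of "t + u" t g g'] der by auto
      then show ?thesis by (intro exI[of _ \<xi>]) auto
    next
      case greater
      then obtain \<xi> where "t < \<xi>" "\<xi> < t + u" "g (t + u) - g t = (t + u - t) * g' \<xi>"
        using MVT2[of t "t + u" g g'] der by auto
      then show ?thesis by (intro exI[of _ \<xi>]) auto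
    qed (auto intro: exI[of _ t])
    then obtain \<xi> where \<xi>: "\<bar>\<xi> - t\<bar> \<le> \<bar>u\<bar>" "g (t + u) - g t = u * g' \<xi>" by blast
    have "\<eta> \<le> \<bar>g' \<xi>\<bar>"
    proof (rule far)
      fix z assume "g' z = 0"
      from t[OF this] \<xi>(1) u show "\<kappa> \<le> \<bar>\<xi> - z\<bar>" by linarith
    qed
    then show ?thesis unfolding \<xi>(2) abs_mult using mult_right_mono[of \<eta> "\<bar>g' \<xi>\<bar>" "\<bar>u\<bar>"] by (simp add: mult.commute)
  qed
  then show ?thesis using that \<eta>(1) by blast
qed

text \<open>An interval of length \<open>L\<close> meets at most \<open>L / T + 2\<close> cells of
  length \<open>T\<close>; \<open>K\<close> stands for a bound on the number of points per
  cell.\<close>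

definition evenly_spread :: "real set \<Rightarrow> real \<Rightarrow> real \<Rightarrow> bool" where
  "evenly_spread Z K T \<longleftrightarrow> (\<forall>u L. 0 \<le> L \<longrightarrow>
     finite (Z \<inter> {u..u + L}) \<and> real (card (Z \<inter> {u..u + L})) \<le> K * (L / T + 2))"

lemma periodic_zeros_evenly_spread:
  fixes h :: "real \<Rightarrow> real"
  assumes T: "0 < T" and per: "\<And>x. h (x + T) = h x"
    and fin: "\<And>r. finite {x. \<bar>x\<bar> \<le> r \<and> h x = 0}"
  obtains K where "0 < K" "evenly_spread {x. h x = 0} K T"
proof -
  note red = periodic_reduce[where h=h, OF T per]
  define Z where "Z = {x. h x = 0}"
  define F where "F = Z \<inter> {0..T}"
  have finF: "finite F" by (rule finite_subset[OF _ fin[of T]]) (auto simp: F_def Z_def)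
  have main: "finite (Z \<inter> {u..u + L}) \<and> real (card (Z \<inter> {u..u + L})) \<le> (real (card F) + 1) * (L / T + 2)"
    if L: "0 \<le> L" for u L
  proof -
    define I where "I = {\<lfloor>u / T\<rfloor>..\<lfloor>(u + L) / T\<rfloor>}"
    have sub: "Z \<inter> {u..u + L} \<subseteq> (\<lambda>(k, z). z + of_int k * T) ` (I \<times> F)"
    proof
      fix x assume x: "x \<in> Z \<inter> {u..u + L}"
      define k where "k = \<lfloor>x / T\<rfloor>"
      have "u / T \<le> x / T" "x / T \<le> (u + L) / T" using x T by (auto intro!: divide_right_mono)
      then have "k \<in> I" unfolding k_def I_def by (simp add: floor_mono)
      moreover have "x - of_int k * T \<in> {0..T}" unfolding k_def
        using floor_divide_lower[OF T, of x] floor_divide_upper[OF T, of x] by (simp add: distrib_right)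
      moreover have "h (x - of_int k * T) = h x" using red(1)[of "x - of_int k * T" k] by simp
      ultimately show "x \<in> (\<lambda>(k, z). z + of_int k * T) ` (I \<times> F)"
        using x by (intro image_eqI[of _ _ "(k, x - of_int k * T)"]) (auto simp: F_def Z_def)
    qed
    have finI: "finite (I \<times> F)" using finF by (simp add: I_def)
    have f1: "finite (Z \<inter> {u..u + L})" by (rule finite_subset[OF sub]) (use finI in blast)
    have "card (Z \<inter> {u..u + L}) \<le> card (I \<times> F)"
      using surj_card_le[OF finI sub] .
    then have "real (card (Z \<inter> {u..u + L})) \<le> real (card I) * real (card F)"
      by (metis card_cartesian_product of_nat_le_iff of_nat_mult)
    also have "\<dots> \<le> (L / T + 2) * (real (card F) + 1)"
    proof (intro mult_mono)
      have "(u + L) / T = u / T + L / T" by (simp add: add_divide_distrib)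
      then have "of_int (\<lfloor>(u + L) / T\<rfloor> - \<lfloor>u / T\<rfloor> + 1) \<le> L / T + 2" by linarith
      moreover have "L / T + 2 \<ge> 0" using L T by simp
      ultimately show "real (card I) \<le> L / T + 2" unfolding I_def by (simp add: of_nat_nat nat_def[symmetric])
    qed (use L T in auto)
    finally show ?thesis using f1 by (simp add: mult.commute)
  qed
  \<comment> \<open>The summand 1 keeps the constant positive even when \<open>F\<close> is
    empty.\<close>
  show ?thesis
    by (rule that[of "real (card F) + 1"]) (use main in \<open>auto simp: evenly_spread_def Z_def[symmetric]\<close>)
qed

lemma scale_growth:
  fixes c :: "nat \<Rightarrow> real"
  assumes "\<And>j. \<rho> * \<bar>c j\<bar> \<le> \<bar>c (Suc j)\<bar>" "0 \<le> \<rho>"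
  shows "\<rho> ^ j * \<bar>c 0\<bar> \<le> \<bar>c j\<bar>"
proof (induction j)
  case (Suc j)
  then have "\<rho> * (\<rho> ^ j * \<bar>c 0\<bar>) \<le> \<rho> * \<bar>c j\<bar>" using assms by (intro mult_left_mono)
  then show ?case using assms(1)[of j] by (simp add: mult.assoc)
qed simp

lemma scale_ge:
  fixes c :: "nat \<Rightarrow> real"
  assumes c: "\<And>j. \<rho> * \<bar>c j\<bar> \<le> \<bar>c (Suc j)\<bar>" and \<rho>: "1 \<le> \<rho>"
  shows "\<bar>c 0\<bar> \<le> \<bar>c j\<bar>"
proof -
  have "1 * \<bar>c 0\<bar> \<le> \<rho> ^ j * \<bar>c 0\<bar>" using \<rho> by (intro mult_right_mono) auto
  then show ?thesis using scale_growth[where c=c, OF c, of j] \<rho> by simp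
qed

text \<open>The radius \<open>2 * \<kappa>\<close> is the margin required by
  \<open>increment_lower_bound_away_from_zeros\<close>, so the points outside are the good ones at
  scale \<open>j\<close>.\<close>

definition near_zeros :: "real set \<Rightarrow> real \<Rightarrow> (nat \<Rightarrow> real) \<Rightarrow> (nat \<Rightarrow> real) \<Rightarrow> nat \<Rightarrow> real set" where
  "near_zeros Z \<kappa> c \<theta> j = {x. \<exists>z\<in>Z. \<bar>c j * x + \<theta> j - z\<bar> < 2 * \<kappa>}"

lemma open_near_zeros: "open (near_zeros Z \<kappa> c \<theta> j)"
proof -
  have "near_zeros Z \<kappa> c \<theta> j = (\<Union>z\<in>Z. {x. \<bar>c j * x + \<theta> j - z\<bar> < 2 * \<kappa>})"
    by (auto simp: near_zeros_def)
  then show ?thesis by (auto intro!: open_UN open_Collect_less continuous_intros)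
qed

text \<open>The range is half-open so that \<open>k = N\<close> gives all of \<open>{0..T}\<close>:
  no condition is left when the scale just below \<open>N\<close> is good.\<close>

definition bad_points :: "real set \<Rightarrow> real \<Rightarrow> real \<Rightarrow> (nat \<Rightarrow> real) \<Rightarrow> (nat \<Rightarrow> real) \<Rightarrow> nat \<Rightarrow> nat \<Rightarrow> real set" where
  "bad_points Z T \<kappa> c \<theta> k N = {0..T} \<inter> (\<Inter>j\<in>{k..<N}. near_zeros Z \<kappa> c \<theta> j)"

lemma bad_points_sets: "bad_points Z T \<kappa> c \<theta> k N \<in> sets borel"
proof -
  have "{0..T} \<inter> (\<Inter>j\<in>{k..<N}. near_zeros Z \<kappa> c \<theta> j) \<in> sets borel"
    using open_near_zeros by (intro sets.Int) (auto intro!: borel_open open_INT)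
  then show ?thesis by (simp add: bad_points_def)
qed

text \<open>Induction over the scales. The next scale stretches an interval of the cover by a
  further factor \<open>R\<close>, and the stretched interval comes near at most
  \<open>Q * R\<close> points of \<open>Z\<close>. The count thus grows like
  \<open>\<bar>c (k + n)\<bar> * Q ^ n\<close>, where \<open>Q ^ n\<close> is the gain from being
  bad at \<open>n\<close> further scales.\<close>

lemma bad_points_cover:
  fixes c \<theta> :: "nat \<Rightarrow> real"
  assumes T: "0 < T" and K: "0 < K" and Z: "evenly_spread Z K T"
    and \<rho>: "1 < \<rho>" and c0: "c 0 \<noteq> 0" and c: "\<And>j. \<rho> * \<bar>c j\<bar> \<le> \<bar>c (Suc j)\<bar>"
  defines "\<kappa> \<equiv> 1 / \<rho>" and "Q \<equiv> K * (8 / T + 2) / \<rho>"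
  shows "\<exists>S. finite S \<and> bad_points Z T \<kappa> c \<theta> k (Suc (k + n)) \<subseteq> (\<Union>p\<in>S. {p - 2 * \<kappa> / \<bar>c (k + n)\<bar>..p + 2 * \<kappa> / \<bar>c (k + n)\<bar>})
    \<and> real (card S) \<le> K * (1 + (4 / T + 2) / \<bar>c 0\<bar>) * \<bar>c (k + n)\<bar> * Q ^ n"
proof (induction n)
  case 0
  have \<kappa>: "0 < \<kappa>" "\<kappa> < 1" using \<rho> by (auto simp: \<kappa>_def)
  have ck: "\<bar>c 0\<bar> \<le> \<bar>c k\<bar>" using scale_ge[where c=c, OF c] \<rho> by simp
  then have ck0: "c k \<noteq> 0" using c0 by auto
  \<comment> \<open>The image of \<open>{0..T}\<close> at scale \<open>k\<close>, widened by
    \<open>2 * \<kappa>\<close> on either side; \<open>min\<close> and the absolute value treat both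
    signs of \<open>c k\<close>.\<close>
  define u where "u = min (c k * T) 0 + \<theta> k - 2 * \<kappa>"
  define L where "L = \<bar>c k\<bar> * T + 4 * \<kappa>"
  have L: "0 \<le> L" using T \<kappa> by (simp add: L_def)
  define S where "S = (\<lambda>z. (z - \<theta> k) / c k) ` (Z \<inter> {u..u + L})"
  from Z L have fin: "finite (Z \<inter> {u..u + L})" and card: "real (card (Z \<inter> {u..u + L})) \<le> K * (L / T + 2)"
    by (auto simp: evenly_spread_def)
  show ?case
  proof (intro exI[of _ S] conjI)
    show "finite S" using fin by (simp add: S_def)
    show "bad_points Z T \<kappa> c \<theta> k (Suc (k + 0)) \<subseteq> (\<Union>p\<in>S. {p - 2 * \<kappa> / \<bar>c (k + 0)\<bar>..p + 2 * \<kappa> / \<bar>c (k + 0)\<bar>})"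
    proof
      fix x assume "x \<in> bad_points Z T \<kappa> c \<theta> k (Suc (k + 0))"
      then obtain z where x: "0 \<le> x" "x \<le> T" and z: "z \<in> Z" "\<bar>c k * x + \<theta> k - z\<bar> < 2 * \<kappa>"
        by (auto simp: bad_points_def near_zeros_def)
      have "min (c k * T) 0 \<le> c k * x \<and> c k * x \<le> min (c k * T) 0 + \<bar>c k\<bar> * T"
      proof (cases "c k \<ge> 0")
        case True
        then show ?thesis using x T mult_left_mono[of x T "c k"] by simp
      next
        case False
        then show ?thesis using x T mult_left_mono_neg[of x T "c k"] mult_nonpos_nonneg[of "c k" x] mult_nonpos_nonneg[of "c k" T] by simp
      qed
      then have "z \<in> {u..u + L}" using z(2) unfolding u_def L_def by auto
      then have "(z - \<theta> k) / c k \<in> S" using z by (auto simp: S_def)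
      moreover have "\<bar>x - (z - \<theta> k) / c k\<bar> \<le> 2 * \<kappa> / \<bar>c k\<bar>"
      proof -
        have "x - (z - \<theta> k) / c k = (c k * x + \<theta> k - z) / c k" using ck0 by (simp add: field_simps)
        then show ?thesis using z(2) by (simp add: abs_divide divide_right_mono)
      qed
      ultimately show "x \<in> (\<Union>p\<in>S. {p - 2 * \<kappa> / \<bar>c (k + 0)\<bar>..p + 2 * \<kappa> / \<bar>c (k + 0)\<bar>})"
        by (intro UN_I[of "(z - \<theta> k) / c k"]) (auto simp: abs_le_iff)
    qed
    have "real (card S) \<le> real (card (Z \<inter> {u..u + L}))" unfolding S_def using fin by (simp add: card_image_le)
    also have "\<dots> \<le> K * (L / T + 2)" by (rule card)
    also have "L / T + 2 \<le> \<bar>c k\<bar> + (4 / T + 2)"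
      using T \<kappa> by (simp add: L_def field_simps)
    also have "\<dots> \<le> \<bar>c k\<bar> + (4 / T + 2) * (\<bar>c k\<bar> / \<bar>c 0\<bar>)"
      using ck c0 T mult_left_mono[of 1 "\<bar>c k\<bar> / \<bar>c 0\<bar>" "4 / T + 2"] by simp
    also have "\<dots> = (1 + (4 / T + 2) / \<bar>c 0\<bar>) * \<bar>c k\<bar>" by (simp add: distrib_right)
    finally show "real (card S) \<le> K * (1 + (4 / T + 2) / \<bar>c 0\<bar>) * \<bar>c (k + 0)\<bar> * Q ^ 0"
      using K by (simp add: mult.assoc)
  qed
next
  case (Suc n)
  have \<kappa>: "0 < \<kappa>" "\<kappa> < 1" using \<rho> by (auto simp: \<kappa>_def)
  define i where "i = k + n"
  have "\<bar>c 0\<bar> \<le> \<bar>c i\<bar>" using scale_ge[where c=c, OF c] \<rho> by simp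
  then have ci: "c i \<noteq> 0" using c0 by auto
  define R where "R = \<bar>c (Suc i)\<bar> / \<bar>c i\<bar>"
  have R: "\<rho> \<le> R" using c[of i] ci by (simp add: R_def field_simps)
  have cSi: "c (Suc i) \<noteq> 0" using R \<rho> by (auto simp: R_def)
  \<comment> \<open>The choice \<open>\<kappa> = 1 / \<rho>\<close> is made for this: the additive
    constants in the count of zeros are absorbed into multiples of
    \<open>\<kappa> * R\<close>.\<close>
  have \<kappa>R: "1 \<le> \<kappa> * R" using R \<rho> by (simp add: \<kappa>_def)
  obtain S where S: "finite S" "bad_points Z T \<kappa> c \<theta> k (Suc i) \<subseteq> (\<Union>p\<in>S. {p - 2 * \<kappa> / \<bar>c i\<bar>..p + 2 * \<kappa> / \<bar>c i\<bar>})"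
    "real (card S) \<le> K * (1 + (4 / T + 2) / \<bar>c 0\<bar>) * \<bar>c i\<bar> * Q ^ n"
    using Suc unfolding i_def by blast
  \<comment> \<open>The interval has radius \<open>2 * \<kappa> * R\<close> after stretching, and
    the zero may lie another \<open>2 * \<kappa>\<close> away.\<close>
  define w where "w = 2 * \<kappa> * R + 2 * \<kappa>"
  have w: "0 \<le> 2 * w" using \<kappa> R \<rho> by (simp add: w_def)
  define J where "J p = Z \<inter> {c (Suc i) * p + \<theta> (Suc i) - w..c (Suc i) * p + \<theta> (Suc i) - w + 2 * w}" for p
  from Z w have fin: "finite (J p)" and card: "real (card (J p)) \<le> K * (2 * w / T + 2)" for p
    unfolding J_def evenly_spread_def by blast+
  define S' where "S' = (\<Union>p\<in>S. (\<lambda>z. (z - \<theta> (Suc i)) / c (Suc i)) ` J p)"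
  show ?case
  proof (intro exI[of _ S'] conjI)
    show "finite S'" using fin S by (simp add: S'_def)
    show "bad_points Z T \<kappa> c \<theta> k (Suc (k + Suc n)) \<subseteq> (\<Union>p\<in>S'. {p - 2 * \<kappa> / \<bar>c (k + Suc n)\<bar>..p + 2 * \<kappa> / \<bar>c (k + Suc n)\<bar>})"
    proof
      fix x assume "x \<in> bad_points Z T \<kappa> c \<theta> k (Suc (k + Suc n))"
      then have x: "x \<in> bad_points Z T \<kappa> c \<theta> k (Suc i)" "x \<in> near_zeros Z \<kappa> c \<theta> (Suc i)"
        by (auto simp: bad_points_def i_def)
      then obtain z where z: "z \<in> Z" "\<bar>c (Suc i) * x + \<theta> (Suc i) - z\<bar> < 2 * \<kappa>"
        by (auto simp: near_zeros_def)
      from x S obtain p where p: "p \<in> S" "\<bar>x - p\<bar> \<le> 2 * \<kappa> / \<bar>c i\<bar>"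
        by (fastforce simp: abs_le_iff)
      have "\<bar>c (Suc i) * x - c (Suc i) * p\<bar> = \<bar>c (Suc i)\<bar> * \<bar>x - p\<bar>"
        by (simp add: abs_mult[symmetric] algebra_simps)
      also have "\<dots> \<le> \<bar>c (Suc i)\<bar> * (2 * \<kappa> / \<bar>c i\<bar>)" using p by (intro mult_left_mono) auto
      also have "\<dots> = 2 * \<kappa> * R" by (simp add: R_def)
      finally have "\<bar>c (Suc i) * x - c (Suc i) * p\<bar> \<le> 2 * \<kappa> * R" .
      then have "\<bar>c (Suc i) * p + \<theta> (Suc i) - z\<bar> \<le> w" using z(2) unfolding w_def by linarith
      then have "z \<in> J p" using z(1) unfolding J_def by auto
      then have "(z - \<theta> (Suc i)) / c (Suc i) \<in> S'" using p by (auto simp: S'_def)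
      moreover have "\<bar>x - (z - \<theta> (Suc i)) / c (Suc i)\<bar> \<le> 2 * \<kappa> / \<bar>c (Suc i)\<bar>"
      proof -
        have "x - (z - \<theta> (Suc i)) / c (Suc i) = (c (Suc i) * x + \<theta> (Suc i) - z) / c (Suc i)" using cSi by (simp add: field_simps)
        then show ?thesis using z(2) by (simp add: abs_divide divide_right_mono)
      qed
      ultimately show "x \<in> (\<Union>p\<in>S'. {p - 2 * \<kappa> / \<bar>c (k + Suc n)\<bar>..p + 2 * \<kappa> / \<bar>c (k + Suc n)\<bar>})"
        by (intro UN_I[of "(z - \<theta> (Suc i)) / c (Suc i)"]) (auto simp: abs_le_iff i_def)
    qed
    have "card S' \<le> (\<Sum>p\<in>S. card ((\<lambda>z. (z - \<theta> (Suc i)) / c (Suc i)) ` J p))"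
      unfolding S'_def using S by (intro card_UN_le)
    also have "\<dots> \<le> (\<Sum>p\<in>S. card (J p))" using fin by (intro sum_mono card_image_le)
    finally have "real (card S') \<le> (\<Sum>p\<in>S. real (card (J p)))"
      by (metis of_nat_le_iff of_nat_sum)
    also have "\<dots> \<le> (\<Sum>p\<in>S. K * (2 * w / T + 2))" by (intro sum_mono card)
    also have "\<dots> = real (card S) * (K * (2 * w / T + 2))" by simp
    also have "\<dots> \<le> real (card S) * (Q * R)"
    proof (intro mult_left_mono)
      have "2 * w \<le> 8 * (\<kappa> * R)" using \<kappa> R \<rho> by (simp add: w_def)
      then have "2 * w / T + 2 \<le> 8 * (\<kappa> * R) / T + 2 * (\<kappa> * R)" 
        using T \<kappa>R by (intro add_mono divide_right_mono) auto
      also have "\<dots> = (8 / T + 2) * (\<kappa> * R)" by (simp add: algebra_simps)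
      finally have "K * (2 * w / T + 2) \<le> K * ((8 / T + 2) * (\<kappa> * R))" using K by (intro mult_left_mono) auto
      then show "K * (2 * w / T + 2) \<le> Q * R" by (simp add: Q_def \<kappa>_def)
    qed auto
    also have "\<dots> \<le> (K * (1 + (4 / T + 2) / \<bar>c 0\<bar>) * \<bar>c i\<bar> * Q ^ n) * (Q * R)"
      using S K T R \<rho> by (intro mult_right_mono) (auto simp: Q_def)
    also have "\<dots> = K * (1 + (4 / T + 2) / \<bar>c 0\<bar>) * \<bar>c (Suc i)\<bar> * Q ^ Suc n"
      using ci by (simp add: R_def)
    finally show "real (card S') \<le> K * (1 + (4 / T + 2) / \<bar>c 0\<bar>) * \<bar>c (k + Suc n)\<bar> * Q ^ Suc n"
      by (simp add: i_def)
  qed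
qed

text \<open>Number of intervals times their length: the factor \<open>\<bar>c i\<bar>\<close>
  cancels and a power of \<open>Q\<close> remains.\<close>

lemma bad_points_measure:
  fixes c \<theta> :: "nat \<Rightarrow> real"
  assumes T: "0 < T" and K: "0 < K" and Z: "evenly_spread Z K T"
    and \<rho>: "1 < \<rho>" and c0: "c 0 \<noteq> 0" and c: "\<And>j. \<rho> * \<bar>c j\<bar> \<le> \<bar>c (Suc j)\<bar>"
  defines "\<kappa> \<equiv> 1 / \<rho>" and "Q \<equiv> K * (8 / T + 2) / \<rho>"
  obtains C where "0 < C"
    "\<And>k n. emeasure lborel (bad_points Z T \<kappa> c \<theta> k (k + n)) \<le> ennreal (C * Q ^ n)"
proof -
  have \<kappa>: "0 < \<kappa>" "\<kappa> < 1" using \<rho> by (auto simp: \<kappa>_def)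
  have Q: "0 < Q" using K T \<rho> by (simp add: Q_def add_pos_pos)
  define C0 where "C0 = K * (1 + (4 / T + 2) / \<bar>c 0\<bar>)"
  have C0: "0 < C0" using K T c0 by (simp add: C0_def add_pos_pos)
  \<comment> \<open>\<open>T\<close> serves \<open>n = 0\<close>. The division by \<open>Q\<close>
    is there because \<open>n\<close> bad scales yield only the power \<open>n - 1\<close>.\<close>
  define C where "C = T + 4 * C0 / Q"
  show ?thesis
  proof
    show "0 < C" using T C0 Q by (simp add: C_def add_pos_pos)
    fix k n
    show "emeasure lborel (bad_points Z T \<kappa> c \<theta> k (k + n)) \<le> ennreal (C * Q ^ n)"
    proof (cases n)
      case 0
      have "emeasure lborel (bad_points Z T \<kappa> c \<theta> k (k + n)) \<le> emeasure lborel {0..T}"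
        by (intro emeasure_mono) (auto simp: bad_points_def)
      also have "\<dots> = ennreal T" using T by simp
      also have "\<dots> \<le> ennreal (C * Q ^ n)" using 0 C0 Q by (intro ennreal_leI) (simp add: C_def)
      finally show ?thesis .
    next
      case (Suc n')
      define i where "i = k + n'"
      have "\<bar>c 0\<bar> \<le> \<bar>c i\<bar>" using scale_ge[where c=c, OF c] \<rho> by simp
      then have ci: "c i \<noteq> 0" using c0 by auto
      obtain S where S: "finite S" "bad_points Z T \<kappa> c \<theta> k (Suc i) \<subseteq> (\<Union>p\<in>S. {p - 2 * \<kappa> / \<bar>c i\<bar>..p + 2 * \<kappa> / \<bar>c i\<bar>})"
        "real (card S) \<le> C0 * \<bar>c i\<bar> * Q ^ n'"
        using bad_points_cover[where c=c, OF T K Z \<rho> c0 c, of \<theta> k n'] unfolding i_def C0_def \<kappa>_def Q_def by blast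
      have "emeasure lborel (bad_points Z T \<kappa> c \<theta> k (k + n)) \<le> emeasure lborel (\<Union>p\<in>S. {p - 2 * \<kappa> / \<bar>c i\<bar>..p + 2 * \<kappa> / \<bar>c i\<bar>})"
        using S(1,2) Suc by (intro emeasure_mono) (auto simp: i_def)
      also have "\<dots> \<le> (\<Sum>p\<in>S. emeasure lborel {p - 2 * \<kappa> / \<bar>c i\<bar>..p + 2 * \<kappa> / \<bar>c i\<bar>})"
        using S(1) by (intro emeasure_subadditive_finite) auto
      also have "\<dots> = (\<Sum>p\<in>S. ennreal (4 * \<kappa> / \<bar>c i\<bar>))"
        using \<kappa> by (intro sum.cong refl) simp
      also have "\<dots> = ennreal (real (card S) * (4 * \<kappa> / \<bar>c i\<bar>))"
        by (subst ennreal_mult) (use \<kappa> in \<open>auto simp: ennreal_of_nat_eq_real_of_nat\<close>)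
      also have "\<dots> \<le> ennreal ((C0 * \<bar>c i\<bar> * Q ^ n') * (4 * 1 / \<bar>c i\<bar>))"
        using S(3) \<kappa> by (intro ennreal_leI mult_mono divide_right_mono) auto
      also have "(C0 * \<bar>c i\<bar> * Q ^ n') * (4 * 1 / \<bar>c i\<bar>) = 4 * C0 / Q * Q ^ n"
        using ci Q Suc by simp
      also have "ennreal \<dots> \<le> ennreal (C * Q ^ n)"
        using T Q by (intro ennreal_leI mult_right_mono) (auto simp: C_def)
      finally show ?thesis .
    qed
  qed
qed

section \<open>Finiteness of the energy\<close>

text \<open>Split by distance into shells \<open>l (Suc N) < \<bar>x - y\<bar> \<le> l N\<close> and
  by the finest good scale \<open>k - 1\<close> below \<open>N\<close>. The bound from that scale is
  of order \<open>(1 / P) ^ k\<close>, and the points bad from \<open>k\<close> up to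
  \<open>N\<close> have measure of order \<open>Q ^ (N - k)\<close>. The condition on
  \<open>A\<close> says \<open>Q \<le> 1 / P\<close>, so each pair contributes at most a constant
  times \<open>\<mu> ^ N\<close> with \<open>\<mu> < 1\<close>.\<close>

lemma energy_finite_of_scales:
  fixes c \<theta> :: "nat \<Rightarrow> real" and e :: "real \<Rightarrow> real \<Rightarrow> ennreal"
  assumes T: "0 < T" and K: "0 < K" and Z: "evenly_spread Z K T"
    and \<rho>: "1 < \<rho>" and c0: "c 0 \<noteq> 0" and c: "\<And>j. \<rho> * \<bar>c j\<bar> \<le> \<bar>c (Suc j)\<bar>"
    and \<sigma>: "0 < \<sigma>" "\<And>j. \<bar>c (Suc j)\<bar> \<le> \<sigma> * \<bar>c j\<bar>"
    and A: "0 < A" "K * (8 / T + 2) * A \<le> 1"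
    and s: "1 < s" "\<sigma> powr (s - 1) < A * \<rho>"
    and W: "0 \<le> W"
    and e0: "\<And>x. e x x = 0"
    and e1: "\<And>x y. e x y \<le> ennreal (\<bar>x - y\<bar> powr (-s))"
    and e2: "\<And>x y k. x \<noteq> y \<Longrightarrow> \<bar>c k\<bar> * \<bar>x - y\<bar> \<le> 1 / \<rho> \<Longrightarrow> x \<notin> near_zeros Z (1 / \<rho>) c \<theta> k \<Longrightarrow>
       e x y \<le> ennreal (W / (A ^ k * \<bar>c k\<bar>) * \<bar>x - y\<bar> powr (-s))"
  shows "(\<integral>\<^sup>+x. (\<integral>\<^sup>+y. e x y * indicator {0..T} y \<partial>lborel) * indicator {0..T} x \<partial>lborel) < \<infinity>"
proof -
  define \<kappa> where "\<kappa> = 1 / \<rho>"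
  define Q where "Q = K * (8 / T + 2) / \<rho>"
  have \<kappa>: "0 < \<kappa>" using \<rho> by (simp add: \<kappa>_def)
  have Q: "0 < Q" using K T \<rho> by (simp add: Q_def add_pos_pos)
  obtain C where C: "0 < C"
    "\<And>k n. emeasure lborel (bad_points Z T \<kappa> c \<theta> k (k + n)) \<le> ennreal (C * Q ^ n)"
    using bad_points_measure[where c=c and \<theta>=\<theta>, OF T K Z \<rho> c0 c] unfolding Q_def \<kappa>_def by blast
  define P where "P = A * \<rho>"
  have P: "0 < P" using A \<rho> by (simp add: P_def)
  have QP: "Q \<le> 1 / P"
  proof -
    have "K * (8 / T + 2) \<le> 1 / A" using A by (simp add: pos_le_divide_eq)
    then have "K * (8 / T + 2) / \<rho> \<le> 1 / A / \<rho>" using \<rho> by (intro divide_right_mono) auto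
    then show ?thesis by (simp add: Q_def P_def)
  qed
  have cge: "\<bar>c 0\<bar> \<le> \<bar>c j\<bar>" for j by (rule scale_ge[where c=c, OF c]) (use \<rho> in simp)
  have cpos: "0 < \<bar>c j\<bar>" for j using cge[of j] c0 by auto
  \<comment> \<open>At distances up to \<open>l N\<close> the smallness condition of
    \<open>e2\<close> holds at scale \<open>N\<close> and at all coarser ones.\<close>
  define l where "l N = \<kappa> / \<bar>c N\<bar>" for N
  have lpos: "0 < l N" for N using \<kappa> cpos[of N] unfolding l_def by (rule divide_pos_pos)
  \<comment> \<open>The index is shifted by one: 0 stands for no good scale and uses
    \<open>e1\<close>, while \<open>Suc j\<close> uses \<open>e2\<close> at scale \<open>j\<close>.
    The factor \<open>P\<close> in \<open>W'\<close> compensates for the shift.\<close>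
  define w where "w k = (case k of 0 \<Rightarrow> 1 | Suc j \<Rightarrow> W / (A ^ j * \<bar>c j\<bar>))" for k
  define W' where "W' = 1 + W * P / \<bar>c 0\<bar>"
  have W': "0 \<le> W'" using W P by (simp add: W'_def)
  have wpos: "0 \<le> w k" for k using W A by (simp add: w_def split: nat.split)
  have wle: "w k \<le> W' * (1 / P) ^ k" for k
  proof (cases k)
    case 0
    then show ?thesis using W P by (simp add: w_def W'_def)
  next
    case (Suc j)
    have "A ^ j * (\<rho> ^ j * \<bar>c 0\<bar>) \<le> A ^ j * \<bar>c j\<bar>"
      using A scale_growth[where c=c, OF c, of j] \<rho> by (intro mult_left_mono) auto
    then have "P ^ j * \<bar>c 0\<bar> \<le> A ^ j * \<bar>c j\<bar>" by (simp add: P_def power_mult_distrib mult.assoc)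
    then have "W / (A ^ j * \<bar>c j\<bar>) \<le> W / (P ^ j * \<bar>c 0\<bar>)"
      using W P c0 A cpos[of j] by (intro divide_left_mono mult_pos_pos) auto
    also have "\<dots> = W * P / \<bar>c 0\<bar> * (1 / P) ^ k" using P Suc by (simp add: field_simps)
    also have "\<dots> \<le> W' * (1 / P) ^ k" using P by (intro mult_right_mono) (auto simp: W'_def)
    finally show ?thesis using Suc by (simp add: w_def)
  qed
  \<comment> \<open>\<open>v N\<close> and \<open>w k\<close> bound the two factors of \<open>e x y\<close> when \<open>l (Suc N) < \<bar>x - y\<bar> \<le> l N\<close> and scale \<open>k - 1\<close> is good\<close>
  define v where "v N = l (Suc N) powr (-s)" for N
  let ?G = "\<lambda>k N. bad_points Z T \<kappa> c \<theta> k N"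
  have [measurable]: "?G k N \<in> sets borel" for k N by (rule bad_points_sets)
  have Glev: "\<exists>k\<le>N. x \<in> ?G k N \<and> e x y \<le> ennreal (w k * \<bar>x - y\<bar> powr (-s))"
    if x: "x \<in> {0..T}" and xy: "x \<noteq> y" "\<bar>x - y\<bar> \<le> l N" for x y N
  proof (cases "x \<in> ?G 0 N")
    case True
    then show ?thesis using e1[of x y] by (intro exI[of _ 0]) (simp add: w_def)
  next
    case False
    define F where "F = {j. j < N \<and> x \<notin> near_zeros Z \<kappa> c \<theta> j}"
    have F: "finite F" "F \<noteq> {}" using False x by (auto simp: F_def bad_points_def)
    \<comment> \<open>the finest scale below \<open>N\<close> at which \<open>x\<close> is good\<close>
    define j where "j = Max F"
    have j: "j < N" "x \<notin> near_zeros Z \<kappa> c \<theta> j" using Max_in[OF F] by (auto simp: j_def F_def)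
    have "x \<in> near_zeros Z \<kappa> c \<theta> i" if "Suc j \<le> i" "i < N" for i
    proof (rule ccontr)
      assume "x \<notin> near_zeros Z \<kappa> c \<theta> i"
      then have "i \<le> j" unfolding j_def using that F by (intro Max_ge) (auto simp: F_def)
      then show False using that by simp
    qed
    then have "x \<in> ?G (Suc j) N" using x by (auto simp: bad_points_def)
    moreover have "\<bar>c j\<bar> * \<bar>x - y\<bar> \<le> 1 / \<rho>"
    proof -
      have "\<bar>c j\<bar> \<le> \<bar>c N\<bar>"
      proof (rule lift_Suc_mono_le[of "\<lambda>j. \<bar>c j\<bar>"])
        show "\<bar>c n\<bar> \<le> \<bar>c (Suc n)\<bar>" for n
          using c[of n] \<rho> mult_right_mono[of 1 \<rho> "\<bar>c n\<bar>"] by simp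
      qed (use j in simp)
      then have "\<bar>c j\<bar> * \<bar>x - y\<bar> \<le> \<bar>c N\<bar> * l N" using xy by (intro mult_mono) auto
      then show ?thesis using cpos[of N] by (simp add: l_def \<kappa>_def)
    qed
    ultimately show ?thesis
      using e2[OF xy(1), of j] j by (intro exI[of _ "Suc j"]) (simp add: w_def \<kappa>_def)
  qed
  \<comment> \<open>A full interval around \<open>x\<close> replaces the shell; its length
    \<open>2 * l N\<close> is good enough.\<close>
  define t where "t N k x y = ennreal (v N * w k) * indicator (?G k N) x * indicator {x - l N..x + l N} y" for N k x y
  have [measurable]: "t N k x \<in> borel_measurable borel" for N k x unfolding t_def by measurable
  define q where "q N k x = ennreal (v N * w k * (2 * l N)) * indicator (?G k N) x" for N k x
  have [measurable]: "q N k \<in> borel_measurable borel" for N k unfolding q_def by measurable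
  have q_int: "(\<integral>\<^sup>+x. q N k x \<partial>lborel) = ennreal (v N * w k * (2 * l N)) * emeasure lborel (?G k N)" for N k
    unfolding q_def by (rule nn_integral_cmult_indicator) simp
  have point: "e x y \<le> ennreal (l 0 powr (-s)) + (\<Sum>N. \<Sum>k\<le>N. t N k x y)" if x: "x \<in> {0..T}" for x y
  proof -
    consider "x = y" | "x \<noteq> y" "\<bar>x - y\<bar> > l 0" | "x \<noteq> y" "\<bar>x - y\<bar> \<le> l 0" by linarith
    then show ?thesis
    proof cases
      case 1 then show ?thesis using e0 by simp
    next
      case 2
      have "e x y \<le> ennreal (\<bar>x - y\<bar> powr (-s))" by (rule e1)
      also have "\<dots> \<le> ennreal (l 0 powr (-s))"
        using 2 lpos[of 0] s by (intro ennreal_leI powr_mono2') auto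
      finally show ?thesis by (rule order_trans) simp
    next
      case 3
      have "(\<lambda>N. \<kappa> / \<bar>c 0\<bar> * (1 / \<rho>) ^ N) \<longlonglongrightarrow> \<kappa> / \<bar>c 0\<bar> * 0"
        using \<rho> by (intro tendsto_mult_left LIMSEQ_power_zero) auto
      then have "eventually (\<lambda>N. \<kappa> / \<bar>c 0\<bar> * (1 / \<rho>) ^ N < \<bar>x - y\<bar>) sequentially"
        using 3 by (intro order_tendstoD) auto
      then obtain M where M: "\<kappa> / \<bar>c 0\<bar> * (1 / \<rho>) ^ M < \<bar>x - y\<bar>" by (auto simp: eventually_sequentially)
      have "l M \<le> \<kappa> / (\<rho> ^ M * \<bar>c 0\<bar>)"
        unfolding l_def using scale_growth[where c=c, OF c, of M] \<rho> \<kappa> cpos[of M] c0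
        by (intro divide_left_mono mult_pos_pos) auto
      also have "\<dots> = \<kappa> / \<bar>c 0\<bar> * (1 / \<rho>) ^ M" by (simp add: power_divide)
      finally have "l M < \<bar>x - y\<bar>" using M by simp
      moreover have "\<not> l 0 < \<bar>x - y\<bar>" using 3 by simp
      \<comment> \<open>\<open>Suc N\<close> is the first index whose length falls below the
        distance, which exists because \<open>l\<close> tends to 0.\<close>
      ultimately obtain N where N: "\<not> l N < \<bar>x - y\<bar>" "l (Suc N) < \<bar>x - y\<bar>"
        using ex_least_nat_less[of "\<lambda>N. l N < \<bar>x - y\<bar>" M] by blast
      obtain k where k: "k \<le> N" "x \<in> ?G k N" "e x y \<le> ennreal (w k * \<bar>x - y\<bar> powr (-s))"
        using Glev[OF x 3(1), of N] N by auto
      have "\<bar>x - y\<bar> powr (-s) \<le> v N"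
        unfolding v_def using N lpos[of "Suc N"] s by (intro powr_mono2') auto
      then have "w k * \<bar>x - y\<bar> powr (-s) \<le> v N * w k"
        using wpos[of k] mult_left_mono[of "\<bar>x - y\<bar> powr (-s)" "v N" "w k"] by (simp add: mult.commute)
      then have "e x y \<le> ennreal (v N * w k)"
        using k(3) by (elim order_trans) (rule ennreal_leI)
      also have "\<dots> = t N k x y" using k N unfolding t_def by (auto simp: indicator_def)
      also have "\<dots> \<le> (\<Sum>k\<le>N. t N k x y)" using k by (intro member_le_sum) auto
      also have "\<dots> \<le> (\<Sum>N. \<Sum>k\<le>N. t N k x y)"
        using sum_le_suminf[of "\<lambda>N. \<Sum>k\<le>N. t N k x y" "{N}"] by simp
      finally show ?thesis by (rule order_trans) simp
    qed
  qed
  have inner: "(\<integral>\<^sup>+y. e x y * indicator {0..T} y \<partial>lborel) * indicator {0..T} x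
      \<le> ennreal (l 0 powr (-s) * T) * indicator {0..T} x + (\<Sum>N. \<Sum>k\<le>N. q N k x)" for x
  proof (cases "x \<in> {0..T}")
    case True
    have "(\<integral>\<^sup>+y. e x y * indicator {0..T} y \<partial>lborel)
       \<le> (\<integral>\<^sup>+y. ennreal (l 0 powr (-s)) * indicator {0..T} y + (\<Sum>N. \<Sum>k\<le>N. t N k x y) \<partial>lborel)"
      using point[OF True] by (intro nn_integral_mono) (auto simp: indicator_def)
    also have "\<dots> = ennreal (l 0 powr (-s)) * ennreal T + (\<Sum>N. \<Sum>k\<le>N. (\<integral>\<^sup>+y. t N k x y \<partial>lborel))"
      using T by (simp add: nn_integral_add nn_integral_suminf nn_integral_sum nn_integral_cmult_indicator)
    also have "(\<lambda>N. \<Sum>k\<le>N. (\<integral>\<^sup>+y. t N k x y \<partial>lborel)) = (\<lambda>N. \<Sum>k\<le>N. q N k x)"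
    proof (intro ext sum.cong refl)
      fix N k
      have "(\<integral>\<^sup>+y. t N k x y \<partial>lborel) = ennreal (v N * w k) * indicator (?G k N) x * emeasure lborel {x - l N..x + l N}"
        unfolding t_def by (rule nn_integral_cmult_indicator) simp
      also have "emeasure lborel {x - l N..x + l N} = ennreal (2 * l N)" using lpos[of N] by simp
      also have "ennreal (v N * w k) * indicator (?G k N) x * ennreal (2 * l N) = q N k x"
        unfolding q_def using lpos[of N] wpos[of k]
        by (subst (2) ennreal_mult) (auto simp: v_def mult_ac)
      finally show "(\<integral>\<^sup>+y. t N k x y \<partial>lborel) = q N k x" .
    qed
    finally show ?thesis using True T by (simp add: ennreal_mult)
  qed simp
  define D where "D = 2 * \<sigma> powr s * l 0 powr (1 - s) * W' * C"
  define \<mu> where "\<mu> = \<sigma> powr (s - 1) / P"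
  have D: "0 \<le> D" using W' C by (simp add: D_def)
  have \<mu>: "0 \<le> \<mu>" "\<mu> < 1" using s P by (auto simp: \<mu>_def P_def)
  have term_le: "v N * w k * (2 * l N) * (C * Q ^ (N - k)) \<le> D * \<mu> ^ N" if k: "k \<le> N" for N k
  proof -
    \<comment> \<open>Consecutive lengths differ by at most the factor \<sigma>, so the inner radius
      in \<open>v N\<close> can be traded for \<open>l N\<close> at the cost
      \<open>\<sigma> powr s\<close>.\<close>
    have "\<bar>c (Suc N)\<bar> * (\<kappa> / \<bar>c N\<bar>) \<le> \<sigma> * \<bar>c N\<bar> * (\<kappa> / \<bar>c N\<bar>)"
      using \<sigma> \<kappa> by (intro mult_right_mono) auto
    then have ll: "l N / \<sigma> \<le> l (Suc N)" using \<sigma> cpos[of N] cpos[of "Suc N"] by (simp add: l_def field_simps)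
    have cup: "\<bar>c N\<bar> \<le> \<sigma> ^ N * \<bar>c 0\<bar>"
    proof (induction N)
      case (Suc N)
      then have "\<sigma> * \<bar>c N\<bar> \<le> \<sigma> * (\<sigma> ^ N * \<bar>c 0\<bar>)" using \<sigma> by (intro mult_left_mono) auto
      then show ?case using \<sigma>(2)[of N] by (simp add: mult.assoc)
    qed simp
    have l0: "l 0 / \<sigma> ^ N \<le> l N"
    proof -
      have "\<kappa> / (\<sigma> ^ N * \<bar>c 0\<bar>) \<le> \<kappa> / \<bar>c N\<bar>"
        using cup \<kappa> \<sigma> cpos by (intro divide_left_mono mult_pos_pos) auto
      then show ?thesis by (simp add: l_def mult.commute)
    qed
    have "v N \<le> (l N / \<sigma>) powr (-s)"
      unfolding v_def using ll lpos[of N] \<sigma> s by (intro powr_mono2') auto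
    also have "\<dots> = \<sigma> powr s * l N powr (-s)"
      using lpos[of N] \<sigma> by (simp add: powr_divide powr_minus field_simps)
    finally have "v N * l N \<le> \<sigma> powr s * l N powr (-s) * l N" using lpos[of N] by (intro mult_right_mono) auto
    also have "\<dots> = \<sigma> powr s * l N powr (1 - s)" using lpos[of N] by (simp add: powr_diff powr_minus field_simps)
    also have "l N powr (1 - s) \<le> (l 0 / \<sigma> ^ N) powr (1 - s)"
      using l0 lpos[of 0] \<sigma> s by (intro powr_mono2') auto
    also have "(l 0 / \<sigma> ^ N) powr (1 - s) = l 0 powr (1 - s) * (\<sigma> powr (s - 1)) ^ N"
    proof -
      have "(\<sigma> ^ N) powr (1 - s) = \<sigma> powr (real N * (1 - s))"
        using \<sigma> by (simp add: powr_realpow[symmetric] powr_powr)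
      also have "\<dots> = 1 / \<sigma> powr (real N * (s - 1))"
        by (subst powr_minus_divide[symmetric]) (simp add: algebra_simps)
      also have "\<sigma> powr (real N * (s - 1)) = (\<sigma> powr (s - 1)) ^ N"
        using \<sigma> by (simp add: powr_realpow[symmetric] powr_powr mult.commute)
      finally show ?thesis using lpos[of 0] \<sigma> by (simp add: powr_divide)
    qed
    finally have vl: "v N * l N \<le> \<sigma> powr s * (l 0 powr (1 - s) * (\<sigma> powr (s - 1)) ^ N)"
      by (simp add: mult_left_mono)
    \<comment> \<open>The balance on which the argument rests: loss at the good scale and smallness
      of the bad set multiply to the same bound for every \<open>k\<close>.\<close>
    have "w k * Q ^ (N - k) \<le> (W' * (1 / P) ^ k) * (1 / P) ^ (N - k)"
      using wle[of k] QP Q W' P by (intro mult_mono power_mono) auto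
    also have "\<dots> = W' * (1 / P) ^ N" using k by (simp add: mult.assoc power_add[symmetric])
    finally have wq: "w k * Q ^ (N - k) \<le> W' * (1 / P) ^ N" .
    have "v N * w k * (2 * l N) * (C * Q ^ (N - k)) = 2 * C * ((v N * l N) * (w k * Q ^ (N - k)))" by (simp add: mult_ac)
    also have "\<dots> \<le> 2 * C * ((\<sigma> powr s * (l 0 powr (1 - s) * (\<sigma> powr (s - 1)) ^ N)) * (W' * (1 / P) ^ N))"
      by (intro mult_left_mono mult_mono[OF vl wq]) (use C wpos[of k] Q in auto)
    also have "\<dots> = D * \<mu> ^ N" by (simp add: D_def \<mu>_def power_divide mult_ac)
    finally show ?thesis .
  qed
  have "(\<integral>\<^sup>+x. (\<integral>\<^sup>+y. e x y * indicator {0..T} y \<partial>lborel) * indicator {0..T} x \<partial>lborel)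
    \<le> (\<integral>\<^sup>+x. ennreal (l 0 powr (-s) * T) * indicator {0..T} x + (\<Sum>N. \<Sum>k\<le>N. q N k x) \<partial>lborel)"
    by (intro nn_integral_mono inner)
  also have "\<dots> = ennreal (l 0 powr (-s) * T) * ennreal T + (\<Sum>N. \<Sum>k\<le>N. ennreal (v N * w k * (2 * l N)) * emeasure lborel (?G k N))"
    using T by (simp add: nn_integral_add nn_integral_suminf nn_integral_sum nn_integral_cmult_indicator q_int)
  also have "\<dots> \<le> ennreal (l 0 powr (-s) * T) * ennreal T + (\<Sum>N. ennreal (D * (real (Suc N) * \<mu> ^ N)))"
  proof (intro add_left_mono suminf_le)
    fix N
    have "(\<Sum>k\<le>N. ennreal (v N * w k * (2 * l N)) * emeasure lborel (?G k N)) \<le> (\<Sum>k\<le>N. ennreal (D * \<mu> ^ N))"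
    proof (rule sum_mono)
      fix k assume k: "k \<in> {..N}"
      have "ennreal (v N * w k * (2 * l N)) * emeasure lborel (?G k N) \<le> ennreal (v N * w k * (2 * l N)) * ennreal (C * Q ^ (N - k))"
        using C(2)[of k "N - k"] k by (intro mult_left_mono) auto
      also have "\<dots> = ennreal (v N * w k * (2 * l N) * (C * Q ^ (N - k)))"
        using C Q wpos[of k] lpos[of N] by (intro ennreal_mult[symmetric]) (auto simp: v_def)
      also have "\<dots> \<le> ennreal (D * \<mu> ^ N)" using term_le k by (intro ennreal_leI) auto
      finally show "ennreal (v N * w k * (2 * l N)) * emeasure lborel (?G k N) \<le> ennreal (D * \<mu> ^ N)" .
    qed
    also have "\<dots> = ennreal (real (Suc N) * (D * \<mu> ^ N))"
      by (subst ennreal_mult) (use D \<mu> in \<open>auto simp: ennreal_of_nat_eq_real_of_nat\<close>)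
    finally show "(\<Sum>k\<le>N. ennreal (v N * w k * (2 * l N)) * emeasure lborel (?G k N)) \<le> ennreal (D * (real (Suc N) * \<mu> ^ N))"
      by (simp add: mult_ac)
  qed auto
  also have "(\<Sum>N. ennreal (D * (real (Suc N) * \<mu> ^ N))) = ennreal (\<Sum>N. D * (real (Suc N) * \<mu> ^ N))"
  proof (rule suminf_ennreal2)
    \<comment> \<open>The factor \<open>Suc N\<close> counts the choices of \<open>k\<close>, which
      makes this the derivative of a geometric series.\<close>
    show "summable (\<lambda>N. D * (real (Suc N) * \<mu> ^ N))"
      using geometric_deriv_sums[of \<mu>] \<mu> by (intro summable_mult) (auto simp: sums_iff)
  qed (use D \<mu> in auto)
  also have "ennreal (l 0 powr (-s) * T) * ennreal T + ennreal (\<Sum>N. D * (real (Suc N) * \<mu> ^ N)) < \<infinity>"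
    by (simp add: ennreal_mult_less_top)
  finally show ?thesis .
qed

text \<open>Below the critical exponent \<open>b powr (s - 1) < a * b\<close> holds with room for
  replacing \<open>b\<close> by nearby bounds on the ratios of \<open>bs\<close>. Taking every
  \<open>m\<close>-th scale preserves the inequality in \<open>m\<close>-th powers and makes
  \<open>K * (8 / T + 2) * a ^ m\<close> small, as sparse scales require.\<close>

lemma energy_integral_finite:
  fixes bs \<theta> :: "nat \<Rightarrow> real" and g g' :: "real \<Rightarrow> real" and e :: "real \<Rightarrow> real \<Rightarrow> ennreal"
  assumes a: "0 < a" "a < 1" and b: "1 < b"
    and bs: "(\<lambda>n. bs (Suc n) / bs n) \<longlonglongrightarrow> b"
    and der: "\<And>x. (g has_real_derivative g' x) (at x)" and cont: "continuous_on UNIV g'"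
    and T: "0 < T" and per: "\<And>x. g (x + T) = g x"
    and fin: "\<And>r. finite {x. \<bar>x\<bar> \<le> r \<and> g' x = 0}"
    and s: "1 < s" "s < 2 + ln a / ln b" and H: "0 \<le> H"
    and e0: "\<And>x. e x x = 0"
    and e1: "\<And>x y. e x y \<le> ennreal (\<bar>x - y\<bar> powr (-s))"
    and e2: "\<And>x y n. x \<noteq> y \<Longrightarrow> g (bs n * x + \<theta> n) \<noteq> g (bs n * y + \<theta> n) \<Longrightarrow>
       e x y \<le> ennreal (H * \<bar>x - y\<bar> powr (1 - s) / (a ^ n * \<bar>g (bs n * x + \<theta> n) - g (bs n * y + \<theta> n)\<bar>))"
  shows "(\<integral>\<^sup>+x. (\<integral>\<^sup>+y. e x y * indicator {0..T} y \<partial>lborel) * indicator {0..T} x \<partial>lborel) < \<infinity>"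
proof -
  define Z where "Z = {x. g' x = 0}"
  obtain K where K: "0 < K" "evenly_spread Z K T"
    using periodic_zeros_evenly_spread[OF T periodic_derivative[OF der per] fin] unfolding Z_def by blast
  have "b powr (s - 1) < a * b"
  proof -
    have "(s - 2) * ln b < ln a" using s b by (simp add: field_simps)
    then have "(s - 1) * ln b < ln a + ln b" by (simp add: algebra_simps)
    then have "ln (b powr (s - 1)) < ln (a * b)" using a b by (simp add: ln_powr ln_mult)
    then show ?thesis using a b by (subst (asm) ln_less_cancel_iff) auto
  qed
  moreover have "((\<lambda>\<epsilon>. (b + \<epsilon>) powr (s - 1)) \<longlongrightarrow> (b + 0) powr (s - 1)) (at_right 0)"
    "((\<lambda>\<epsilon>. a * (b - \<epsilon>)) \<longlongrightarrow> a * (b - 0)) (at_right 0)"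
    by (intro tendsto_intros; use b in simp)+
  \<comment> \<open>The midpoint separates the two sides, so a small \<epsilon> can be chosen for
    each side on its own.\<close>
  moreover define mid where "mid = (b powr (s - 1) + a * b) / 2"
  ultimately have "eventually (\<lambda>\<epsilon>. (b + \<epsilon>) powr (s - 1) < mid) (at_right 0)" "eventually (\<lambda>\<epsilon>. mid < a * (b - \<epsilon>)) (at_right 0)"
    by (auto intro: order_tendstoD)
  moreover have "eventually (\<lambda>\<epsilon>. 0 < \<epsilon> \<and> \<epsilon> < b - 1) (at_right 0)"
    using eventually_at_right_real[of 0 "b - 1"] b by (auto elim: eventually_mono)
  ultimately have "eventually (\<lambda>\<epsilon>. (b + \<epsilon>) powr (s - 1) < mid \<and> mid < a * (b - \<epsilon>) \<and> 0 < \<epsilon> \<and> \<epsilon> < b - 1) (at_right 0)"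
    by (auto intro: eventually_conj)
  then obtain \<epsilon> where \<epsilon>: "(b + \<epsilon>) powr (s - 1) < mid" "mid < a * (b - \<epsilon>)" "0 < \<epsilon>" "\<epsilon> < b - 1"
    using eventually_happens'[OF trivial_limit_at_right_real] by blast
  define r1 where "r1 = b - \<epsilon>"
  define r2 where "r2 = b + \<epsilon>"
  have r: "1 < r1" "r1 < b" "b < r2" "r2 powr (s - 1) < a * r1" using \<epsilon> by (auto simp: r1_def r2_def)
  have "eventually (\<lambda>n. r1 < bs (Suc n) / bs n \<and> bs (Suc n) / bs n < r2) sequentially"
    using order_tendstoD[OF bs] r by (intro eventually_conj) auto
  then obtain n0 where n0: "\<And>n. n \<ge> n0 \<Longrightarrow> r1 < bs (Suc n) / bs n \<and> bs (Suc n) / bs n < r2"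
    by (auto simp: eventually_sequentially)
  have bs0: "bs n \<noteq> 0" if "n \<ge> n0" for n using n0[OF that] r by auto
  have ratio: "r1 * \<bar>bs n\<bar> \<le> \<bar>bs (Suc n)\<bar>" "\<bar>bs (Suc n)\<bar> \<le> r2 * \<bar>bs n\<bar>" if "n \<ge> n0" for n
  proof -
    have "r1 \<le> \<bar>bs (Suc n)\<bar> / \<bar>bs n\<bar>" "\<bar>bs (Suc n)\<bar> / \<bar>bs n\<bar> \<le> r2"
      using n0[OF that] r abs_divide[of "bs (Suc n)" "bs n"] by linarith+
    then show "r1 * \<bar>bs n\<bar> \<le> \<bar>bs (Suc n)\<bar>" "\<bar>bs (Suc n)\<bar> \<le> r2 * \<bar>bs n\<bar>"
      using bs0[OF that] by (auto simp: field_simps)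
  qed
  have ratios: "r1 ^ m * \<bar>bs n\<bar> \<le> \<bar>bs (n + m)\<bar> \<and> \<bar>bs (n + m)\<bar> \<le> r2 ^ m * \<bar>bs n\<bar>" if "n \<ge> n0" for n m
  proof (induction m)
    case (Suc m)
    have "r1 * (r1 ^ m * \<bar>bs n\<bar>) \<le> r1 * \<bar>bs (n + m)\<bar>" "r2 * \<bar>bs (n + m)\<bar> \<le> r2 * (r2 ^ m * \<bar>bs n\<bar>)"
      using Suc r by (auto intro!: mult_left_mono)
    then show ?case using ratio[of "n + m"] that by (auto simp: mult.assoc)
  qed simp
  define Kc where "Kc = K * (8 / T + 2)"
  have Kc: "0 < Kc" using K T by (simp add: Kc_def add_pos_pos)
  have "(\<lambda>m. Kc * a ^ m) \<longlonglongrightarrow> Kc * 0" using a by (intro tendsto_mult_left LIMSEQ_power_zero) auto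
  then have "eventually (\<lambda>m. Kc * a ^ m < 1) sequentially" by (intro order_tendstoD) auto
  then obtain m0 where "\<And>m. m \<ge> m0 \<Longrightarrow> Kc * a ^ m < 1" by (auto simp: eventually_sequentially)
  \<comment> \<open>\<open>Kc\<close> does not depend on \<open>m\<close>, so powers of
    \<open>a < 1\<close> overcome it; \<open>m > 0\<close> is needed for
    \<open>\<rho> > 1\<close>.\<close>
  then obtain m where m: "0 < m" "Kc * a ^ m < 1" using that[of "Suc m0"] by (metis le_Suc_eq le_refl zero_less_Suc)
  define \<rho> where "\<rho> = r1 ^ m"
  have \<rho>: "1 < \<rho>" using r m by (simp add: \<rho>_def one_less_power)
  define \<kappa> where "\<kappa> = 1 / \<rho>"
  have \<kappa>: "0 < \<kappa>" using \<rho> by (simp add: \<kappa>_def)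
  obtain \<eta> where \<eta>: "0 < \<eta>"
    "\<And>t u. (\<And>z. g' z = 0 \<Longrightarrow> 2 * \<kappa> \<le> \<bar>t - z\<bar>) \<Longrightarrow> \<bar>u\<bar> \<le> \<kappa> \<Longrightarrow> \<eta> * \<bar>u\<bar> \<le> \<bar>g (t + u) - g t\<bar>"
    using increment_lower_bound_away_from_zeros[OF der cont T per \<kappa>] by blast
  define c where "c k = bs (n0 + k * m)" for k
  define \<phi> where "\<phi> k = \<theta> (n0 + k * m)" for k
  have shift: "n0 + Suc k * m = (n0 + k * m) + m" for k by simp
  \<comment> \<open>\<open>A\<close> becomes \<open>a ^ m\<close> because
    \<open>a ^ n = a ^ n0 * (a ^ m) ^ k\<close> along the subsequence; the leftover
    \<open>a ^ n0\<close> and the constant \<eta> of the increment bound go into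
    \<open>W\<close>.\<close>
  show ?thesis
  proof (rule energy_finite_of_scales[where K=K and Z=Z and \<rho>=\<rho> and c=c and \<theta>=\<phi> and \<sigma>="r2 ^ m" and A="a ^ m" and W="H / (\<eta> * a ^ n0)" and s=s])
    show "\<rho> * \<bar>c j\<bar> \<le> \<bar>c (Suc j)\<bar>" "\<bar>c (Suc j)\<bar> \<le> r2 ^ m * \<bar>c j\<bar>" for j
      unfolding c_def \<rho>_def shift using ratios[of "n0 + j * m" m] by auto
    show "c 0 \<noteq> 0" using bs0 by (simp add: c_def)
    show "K * (8 / T + 2) * a ^ m \<le> 1" using m by (simp add: Kc_def)
    show "(r2 ^ m) powr (s - 1) < a ^ m * \<rho>"
    proof -
      have "(r2 ^ m) powr (s - 1) = (r2 powr (s - 1)) ^ m"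
        using r b by (simp add: powr_realpow[symmetric] powr_powr mult.commute)
      also have "\<dots> < (a * r1) ^ m" using r m by (intro power_strict_mono) auto
      finally show ?thesis by (simp add: \<rho>_def power_mult_distrib)
    qed
    show "0 \<le> H / (\<eta> * a ^ n0)" using H \<eta> a by simp
    show "0 < r2 ^ m" using r b by simp
    fix x y k
    assume xy: "x \<noteq> y" and small: "\<bar>c k\<bar> * \<bar>x - y\<bar> \<le> 1 / \<rho>" and good: "x \<notin> near_zeros Z (1 / \<rho>) c \<phi> k"
    define n where "n = n0 + k * m"
    have ck: "c k = bs n" "\<phi> k = \<theta> n" by (auto simp: c_def \<phi>_def n_def)
    have bn: "bs n \<noteq> 0" using bs0[of n] by (simp add: n_def)
    define \<Delta> where "\<Delta> = \<bar>g (bs n * x + \<theta> n) - g (bs n * y + \<theta> n)\<bar>"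
    have "\<eta> * \<bar>bs n * (y - x)\<bar> \<le> \<bar>g ((bs n * x + \<theta> n) + bs n * (y - x)) - g (bs n * x + \<theta> n)\<bar>"
    proof (rule \<eta>(2))
      show "2 * \<kappa> \<le> \<bar>bs n * x + \<theta> n - z\<bar>" if "g' z = 0" for z
        using good that unfolding near_zeros_def ck Z_def \<kappa>_def by force
      show "\<bar>bs n * (y - x)\<bar> \<le> \<kappa>" using small by (simp add: ck \<kappa>_def abs_mult abs_minus_commute)
    qed
    also have "(bs n * x + \<theta> n) + bs n * (y - x) = bs n * y + \<theta> n" by (simp add: algebra_simps)
    finally have \<Delta>: "\<eta> * (\<bar>bs n\<bar> * \<bar>x - y\<bar>) \<le> \<Delta>" by (simp add: \<Delta>_def abs_mult abs_minus_commute)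
    \<comment> \<open>With the preceding bound this yields the distinct values of \<open>g\<close>
      that \<open>e2\<close> demands.\<close>
    have pos: "0 < \<eta> * (\<bar>bs n\<bar> * \<bar>x - y\<bar>)" using \<eta> bn xy by simp
    have "e x y \<le> ennreal (H * \<bar>x - y\<bar> powr (1 - s) / (a ^ n * \<Delta>))"
      unfolding \<Delta>_def using xy \<Delta> pos by (intro e2) (auto simp: \<Delta>_def)
    also have "\<dots> \<le> ennreal (H * \<bar>x - y\<bar> powr (1 - s) / (a ^ n * (\<eta> * (\<bar>bs n\<bar> * \<bar>x - y\<bar>))))"
      using \<Delta> less_le_trans[OF pos \<Delta>] \<eta>(1) bn xy a H by (intro ennreal_leI divide_left_mono mult_left_mono mult_pos_pos) auto
    also have "H * \<bar>x - y\<bar> powr (1 - s) / (a ^ n * (\<eta> * (\<bar>bs n\<bar> * \<bar>x - y\<bar>)))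
        = H / (\<eta> * a ^ n0) / ((a ^ m) ^ k * \<bar>c k\<bar>) * \<bar>x - y\<bar> powr (-s)"
    proof -
      have "\<bar>x - y\<bar> powr (1 - s) = \<bar>x - y\<bar> * \<bar>x - y\<bar> powr (-s)"
        using xy by (simp add: powr_diff powr_minus field_simps)
      moreover have "a ^ n = a ^ n0 * (a ^ m) ^ k" by (simp add: n_def power_add power_mult[symmetric] mult.commute)
      ultimately show ?thesis using xy by (simp add: ck mult_ac)
    qed
    finally show "e x y \<le> ennreal (H / (\<eta> * a ^ n0) / ((a ^ m) ^ k * \<bar>c k\<bar>) * \<bar>x - y\<bar> powr (-s))" .
  qed (use T K \<rho> a s e0 e1 in auto)
qed

text \<open>By Tonelli the expected energy is the double integral of the expected kernel, which is
  finite. Hence the energy is almost surely finite, and then so is its inner integral at almost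
  every \<open>x\<close>.\<close>

lemma (in prob_space) AE_energy_finite:
  fixes A :: "nat \<Rightarrow> 'a \<Rightarrow> real" and bs \<theta> :: "nat \<Rightarrow> real" and g g' :: "real \<Rightarrow> real"
  assumes a: "0 < a" "a < 1" and b: "1 < b"
    and ind: "indep_vars (\<lambda>_. borel) A UNIV"
    and A: "\<And>n. distr M borel (A n) = uniform_measure lborel {- (a ^ n)<..<a ^ n}"
    and bs: "(\<lambda>n. bs (Suc n) / bs n) \<longlonglongrightarrow> b"
    and der: "\<And>x. (g has_real_derivative g' x) (at x)" and cont: "continuous_on UNIV g'"
    and T: "0 < T" and per: "\<And>x. g (x + T) = g x"
    and fin: "\<And>r. finite {x. \<bar>x\<bar> \<le> r \<and> g' x = 0}"
    and s: "1 < s" "s < 2 + ln a / ln b"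
  defines "f \<equiv> \<lambda>\<omega> x. \<Sum>n. A n \<omega> * g (bs n * x + \<theta> n)"
  shows "AE \<omega> in M. AE x in lborel. x \<in> {0..T} \<longrightarrow>
      (\<integral>\<^sup>+y. ennreal (max \<bar>x - y\<bar> \<bar>f \<omega> x - f \<omega> y\<bar> powr (-s)) * indicator {0..T} y \<partial>lborel) < \<infinity>"
proof -
  have [measurable]: "A n \<in> borel_measurable M" for n
    using ind unfolding indep_vars_def by auto
  have contg: "continuous_on UNIV g" using der by (intro DERIV_continuous_on) auto
  then have [measurable]: "g \<in> borel_measurable borel" by (rule borel_measurable_continuous_onI)
  obtain B where B: "0 \<le> B" "\<And>x. \<bar>g x\<bar> \<le> B" using periodic_bounded[OF T per contg] by blast
  define k where "k \<omega> x y = ennreal (max \<bar>x - y\<bar> \<bar>f \<omega> x - f \<omega> y\<bar> powr (-s))" for \<omega> x y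
  define e where "e x y = (\<integral>\<^sup>+\<omega>. k \<omega> x y \<partial>M)" for x y
  have efin: "(\<integral>\<^sup>+x. (\<integral>\<^sup>+y. e x y * indicator {0..T} y \<partial>lborel) * indicator {0..T} x \<partial>lborel) < \<infinity>"
  proof (rule energy_integral_finite[OF a b bs der cont T per fin s, where H="s / (s - 1)" and \<theta>=\<theta>])
    show "0 \<le> s / (s - 1)" using s by simp
    \<comment> \<open>The kernel on the diagonal is \<open>0 powr (-s)\<close>, which is 0 by
      convention.\<close>
    show "e x x = 0" for x by (simp add: e_def k_def)
    show "e x y \<le> ennreal (\<bar>x - y\<bar> powr (-s))" for x y
    proof (cases "x = y")
      case False
      have "e x y \<le> (\<integral>\<^sup>+\<omega>. ennreal (\<bar>x - y\<bar> powr (-s)) \<partial>M)"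
        unfolding e_def k_def using False s by (intro nn_integral_mono ennreal_leI powr_mono2') auto
      then show ?thesis by (simp add: emeasure_space_1)
    qed (simp add: e_def k_def)
    show "e x y \<le> ennreal (s / (s - 1) * \<bar>x - y\<bar> powr (1 - s) / (a ^ n * \<bar>g (bs n * x + \<theta> n) - g (bs n * y + \<theta> n)\<bar>))"
      if "x \<noteq> y" "g (bs n * x + \<theta> n) \<noteq> g (bs n * y + \<theta> n)" for x y n
      unfolding e_def k_def f_def using that
      by (intro expected_series_kernel[OF a ind A, where u="\<lambda>n. g (bs n * x + \<theta> n)" and v="\<lambda>n. g (bs n * y + \<theta> n)" and B=B] B s) auto
  qed
  interpret L: pair_sigma_finite M lborel ..
  \<comment> \<open>The expectation moves inwards past one integral at a time.\<close>
  have "(\<integral>\<^sup>+\<omega>. (\<integral>\<^sup>+x. (\<integral>\<^sup>+y. k \<omega> x y * indicator {0..T} y \<partial>lborel) * indicator {0..T} x \<partial>lborel) \<partial>M)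
      = (\<integral>\<^sup>+x. (\<integral>\<^sup>+\<omega>. (\<integral>\<^sup>+y. k \<omega> x y * indicator {0..T} y \<partial>lborel) * indicator {0..T} x \<partial>M) \<partial>lborel)"
    by (rule L.Fubini'[symmetric]) (unfold k_def f_def, measurable)
  also have "\<dots> = (\<integral>\<^sup>+x. (\<integral>\<^sup>+\<omega>. (\<integral>\<^sup>+y. k \<omega> x y * indicator {0..T} y \<partial>lborel) \<partial>M) * indicator {0..T} x \<partial>lborel)"
    by (intro nn_integral_cong nn_integral_multc) (unfold k_def f_def, measurable)
  also have "\<dots> = (\<integral>\<^sup>+x. (\<integral>\<^sup>+y. (\<integral>\<^sup>+\<omega>. k \<omega> x y * indicator {0..T} y \<partial>M) \<partial>lborel) * indicator {0..T} x \<partial>lborel)"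
    by (intro nn_integral_cong arg_cong2[where f="(*)"] L.Fubini'[symmetric] refl) (unfold k_def f_def, measurable)
  also have "\<dots> = (\<integral>\<^sup>+x. (\<integral>\<^sup>+y. e x y * indicator {0..T} y \<partial>lborel) * indicator {0..T} x \<partial>lborel)"
    unfolding e_def
    by (intro nn_integral_cong arg_cong2[where f="(*)"] refl nn_integral_multc) (unfold k_def f_def, measurable)
  finally have "(\<integral>\<^sup>+\<omega>. (\<integral>\<^sup>+x. (\<integral>\<^sup>+y. k \<omega> x y * indicator {0..T} y \<partial>lborel) * indicator {0..T} x \<partial>lborel) \<partial>M) \<noteq> \<infinity>"
    using efin by simp
  then have "AE \<omega> in M. (\<integral>\<^sup>+x. (\<integral>\<^sup>+y. k \<omega> x y * indicator {0..T} y \<partial>lborel) * indicator {0..T} x \<partial>lborel) \<noteq> \<infinity>"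
    by (intro nn_integral_PInf_AE) (unfold k_def f_def, measurable)
  then show ?thesis
  proof eventually_elim
    case (elim \<omega>)
    have "AE x in lborel. (\<integral>\<^sup>+y. k \<omega> x y * indicator {0..T} y \<partial>lborel) * indicator {0..T} x \<noteq> \<infinity>"
      using elim by (intro nn_integral_PInf_AE) (unfold k_def f_def, measurable)
    then show ?case
      by eventually_elim (auto simp: k_def less_top split: split_indicator_asm)
  qed
qed

section \<open>The dimension of the graph\<close>

theorem theoremA:
  fixes M :: "'w measure"
    and A :: "nat \<Rightarrow> 'w \<Rightarrow> real"
    and a b T :: real
    and bs \<theta> :: "nat \<Rightarrow> real"
    and g g' :: "real \<Rightarrow> real"
  assumes "prob_space M"
    and "0 < a" "a < 1"
    and "prob_space.indep_vars M (\<lambda>_. borel) A UNIV"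
    and "\<And>n. distr M borel (A n) = uniform_measure lborel {- (a ^ n)<..<a ^ n}"
    and "1 < b" "a * b > 1"
    and "(\<lambda>n. bs (Suc n) / bs n) \<longlonglongrightarrow> b"
    and "\<And>x. (g has_real_derivative g' x) (at x)"
    and "continuous_on UNIV g'"
    and "T > 0" "\<And>x. g (x + T) = g x"
    and "\<And>r. finite {x. \<bar>x\<bar> \<le> r \<and> g' x = 0}"
  shows "AE \<omega> in M.
     (let f = (\<lambda>x. \<Sum>n. A n \<omega> * g (bs n * x + \<theta> n));
          G = graph_on {0..T} f
      in hausdorff_dim G = 2 + ln a / ln b \<and> has_box_dim G (2 + ln a / ln b))"
proof -
  interpret prob_space M by fact
  note a = assms(2,3) and ind = assms(4) and A = assms(5) and b = assms(6) and ab = assms(7)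
    and bs = assms(8) and der = assms(9) and cont = assms(10) and T = assms(11) and per = assms(12)
    and fin = assms(13)
  define D where "D = 2 + ln a / ln b"
  define f where "f = (\<lambda>\<omega> x. \<Sum>n. A n \<omega> * g (bs n * x + \<theta> n))"
  have lnb: "0 < ln b" using b by simp
  \<comment> \<open>\<open>a * b > 1\<close> gives \<open>D > 1\<close>, so exponents
    \<open>s > 1\<close> can approach \<open>D\<close> from below; \<open>a < 1\<close> gives
    \<open>D < 2\<close>, which leaves room for a positive Hoelder exponent.\<close>
  have "0 < ln (a * b)" using ab by (intro ln_gt_zero)
  then have "0 < ln a + ln b" using a b by (simp add: ln_mult)
  then have D1: "1 < D" using lnb by (simp add: D_def field_simps)
  have D2: "D < 2" using lnb a by (simp add: D_def field_simps)
  have contg: "continuous_on UNIV g" using der by (intro DERIV_continuous_on) auto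
  then have [measurable]: "g \<in> borel_measurable borel" by (rule borel_measurable_continuous_onI)
  obtain B where B: "0 \<le> B" "\<And>x. \<bar>g x\<bar> \<le> B" using periodic_bounded[OF T per contg] by blast
  obtain H where H: "0 \<le> H" "\<And>\<gamma> u v. 0 \<le> \<gamma> \<Longrightarrow> \<gamma> \<le> 1 \<Longrightarrow> \<bar>g u - g v\<bar> \<le> H * \<bar>u - v\<bar> powr \<gamma>"
    using periodic_C1_holder[OF der cont T per] by blast
  have [measurable]: "A n \<in> borel_measurable M" for n
    using ind unfolding indep_vars_def by auto
  have bound: "AE \<omega> in M. \<forall>n. \<bar>A n \<omega>\<bar> \<le> a ^ n"
    using a by (intro AE_all_countable[THEN iffD2] allI AE_uniform_bound A) auto
  \<comment> \<open>The exceptional null set depends on the exponent; a countable dense set of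
    exponents permits a common one.\<close>
  define R where "R = \<rat> \<inter> {1<..<D}"
  have "countable R" by (auto simp: R_def intro: countable_Int1 countable_rat)
  have energy: "AE \<omega> in M. \<forall>s\<in>R. AE x in lborel. x \<in> {0..T} \<longrightarrow>
      (\<integral>\<^sup>+y. ennreal (max \<bar>x - y\<bar> \<bar>f \<omega> x - f \<omega> y\<bar> powr (-s)) * indicator {0..T} y \<partial>lborel) < \<infinity>"
    unfolding f_def
    by (intro AE_ball_countable[THEN iffD2] ballI \<open>countable R\<close> AE_energy_finite[OF a b ind A bs der cont T per fin])
      (auto simp: R_def D_def)
  from bound energy have "AE \<omega> in M. hausdorff_dim (graph_on {0..T} (f \<omega>)) = D \<and> has_box_dim (graph_on {0..T} (f \<omega>)) D"
  proof eventually_elim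
    case (elim \<omega>)
    have fm: "f \<omega> \<in> borel_measurable borel" unfolding f_def by measurable
    have low: "\<exists>t c. s < t \<and> t < D \<and> 0 < c \<and> cover_sums_ge t c (graph_on {0..T} (f \<omega>))" if s: "s < D" for s
    proof -
      obtain t where t: "t \<in> \<rat>" "max 1 s < t" "t < D" using Rats_dense_in_real[of "max 1 s" D] s D1 by auto
      then have "t \<in> R" by (auto simp: R_def)
      then obtain c where "0 < c" "cover_sums_ge t c (graph_on {0..T} (f \<omega>))"
        using graph_cover_lower_bound[OF T _ fm, of t] elim(2) t by auto
      then show ?thesis using t by auto
    qed
    have up: "\<exists>C. \<forall>\<delta>\<in>{0<..<1}. \<exists>n. covered_by \<delta> n (graph_on {0..T} (f \<omega>)) \<and> real n \<le> C * \<delta> powr (-t)"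
      if t: "D < t" for t
    proof -
      \<comment> \<open>Capping at the midpoint of \<open>D\<close> and 2 keeps
        \<open>\<gamma> = 2 - t'\<close> positive, and \<open>t' > D > 1\<close> keeps it below
        1.\<close>
      define t' where "t' = min t ((D + 2) / 2)"
      define \<gamma> where "\<gamma> = 2 - t'"
      have t': "D < t'" "t' < 2" "t' \<le> t" using t D2 by (auto simp: t'_def min_def)
      have \<gamma>: "0 < \<gamma>" "\<gamma> \<le> 1" using t' D1 by (auto simp: \<gamma>_def)
      \<comment> \<open>\<open>t' > D\<close> in terms of \<gamma>; this is the convergence
        condition \<open>a * b powr \<gamma> < 1\<close> of the Hoelder estimate.\<close>
      have "\<gamma> * ln b < - ln a" using t' lnb by (simp add: \<gamma>_def D_def field_simps)
      then have "ln (a * b powr \<gamma>) < ln 1" using a b by (simp add: ln_mult ln_powr)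
      then have "a * b powr \<gamma> < 1" using a b by (subst (asm) ln_less_cancel_iff) auto
      from lacunary_series_holder[where \<alpha>="\<lambda>n. A n \<omega>" and g=g and \<theta>=\<theta>,
          OF a b bs elim(1)[rule_format] B(2) H(1) H(2)[OF less_imp_le[OF \<gamma>(1)] \<gamma>(2)] \<gamma>(1) this]
      obtain C where C: "0 \<le> C" "\<And>x y. \<bar>f \<omega> x - f \<omega> y\<bar> \<le> C * \<bar>x - y\<bar> powr \<gamma>"
        unfolding f_def by blast
      define E where "E = (T + 1) * (2 * C + 1) * 2 powr (2 - \<gamma>)"
      have E: "0 \<le> E" using T C by (simp add: E_def)
      have "\<exists>n. covered_by \<delta> n (graph_on {0..T} (f \<omega>)) \<and> real n \<le> E * \<delta> powr (-t)" if \<delta>: "\<delta> \<in> {0<..<1}" for \<delta>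
      proof -
        obtain n where n: "covered_by \<delta> n (graph_on {0..T} (f \<omega>))" "real n \<le> E * \<delta> powr (- (2 - \<gamma>))"
          using holder_graph_covered_by[OF T \<gamma>(2) C(1) C(2), of \<delta>] \<gamma> \<delta> unfolding E_def by auto
        have "\<delta> powr (- (2 - \<gamma>)) \<le> \<delta> powr (-t)" using \<delta> t' by (intro powr_mono') (auto simp: \<gamma>_def)
        then have "real n \<le> E * \<delta> powr (-t)" using n(2) mult_left_mono[OF _ E] order_trans by blast
        then show ?thesis using n by blast
      qed
      then show ?thesis by blast
    qed
    show ?case using hausdorff_dim_eqI[OF _ low up] has_box_dimI[OF _ low up] D1 by auto
  qed
  then show ?thesis unfolding f_def D_def Let_def .
qed

end
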